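(* Let $\mathcal C=\{\tau_k\mid k\in\mathcal K\}$ be a translation-based cipher on $V=(\mathbb F_2)^n=V_1\oplus\cdots\oplus V_b$, $V_j\cong(\mathbb F_2)^m$, with $\ell$ rounds, round maps $\gamma_h,\lambda_h$ and key-schedule $\Phi$. Suppose $\Phi$ is 3-round almost-independent at round $i$ with respect to subgroups $T_1,T_2,T_3$ of $T(V)$ of order at least $2^{n-1}$, for some $2\le i\le\ell-1$, and let $U_j=\{v:\sigma_v\in T_j\}$ for $j=1,2,3$. Suppose that either every S-box composing $\gamma_i$ and $\gamma_{i+1}$ is (1) differentially $2^r$-uniform with $r<m-1$ and (2) strongly $r$-anti-invariant; or every S-box $f$ composing $\gamma_i$ and $\gamma_{i+1}$ is (i) differentially $4$-uniform and (ii) satisfies $\hat n(f)=0$. Suppose further that $\lambda_i$ is strongly proper and $J_{U_2\lambda_i^{-1}}\cap J_{U_1}=\emptyset$. Then there do not exist non-trivial partitions $\mathcal A,\mathcal B$ of $V$ such that for all $k\in\mathcal K$ the map $\tau_k$ maps $\mathcal A$ onto $\mathcal B$. In particular, $\Gamma(\mathcal C)=\langle\tau_k\mid k\in\mathcal K\rangle$ is primitive.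
   Context: Let $m,b>1$, $n=mb$, $V=(\mathbb F_2)^n=V_1\oplus\cdots\oplus V_b$, $V_j\cong(\mathbb F_2)^m$. Permutations act on the right; $\sigma_v:x\mapsto x+v$, $T(V)=\{\sigma_v:v\in V\}$. A parallel map is $\gamma\in\mathrm{Sym}(V)$ with $(v_1\oplus\cdots\oplus v_b)\gamma=v_1\gamma_1\oplus\cdots\oplus v_b\gamma_b$, $\gamma_j\in\mathrm{Sym}(V_j)$ (the S-boxes). A wall is $\bigoplus_{j\in I}V_j$ with $\emptyset\ne I\subsetneq\{1,\dots,b\}$; $\lambda\in\mathrm{GL}(V)$ is strongly proper if no wall is mapped by $\lambda$ into a wall. For a subspace $U$ of dimension $n-1$, $J_U=\{j:V_j\cap U\subsetneq V_j\}$. A tb cipher with $\ell$ rounds has key-independent parallel maps $\gamma_h$ with $0\gamma_h=0$ and $\lambda_h\in\mathrm{GL}(V)$, a key-schedule $\Phi:\mathcal K\to V^\ell$, $k\mapsto(k_1,\dots,k_\ell)$, and encryption functions $\tau_k=\gamma_1\lambda_1\sigma_{k_1}\cdots\gamma_\ell\lambda_\ell\sigma_{k_\ell}$. $\Phi$ is 3-round almost-independent at round $i$ with respect to $T_1,T_2,T_3$ if there are fixed $\bar k_j\in V$ ($j\notin\{i-1,i,i+1\}$) such that for every $(k_{i-1},k_i,k_{i+1})\in U_1\times U_2\times U_3$ the tuple $(\bar k_1,\dots,\bar k_{i-2},k_{i-1},k_i,k_{i+1},\bar k_{i+2},\dots,\bar k_\ell)$ lies in $\mathrm{Im}(\Phi)$.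 For $f:(\mathbb F_2)^m\to(\mathbb F_2)^m$: $\hat f_a(x)=f(x+a)+f(x)$; $f$ is differentially $\delta$-uniform if $\delta=\max_{a\ne0,b}|\{x:\hat f_a(x)=b\}|$; for $f(0)=0$, $f$ is strongly $r$-anti-invariant if for all subspaces $A,B$ with $f(A)=B$, either $\dim A=\dim B<m-r$ or $A=B=(\mathbb F_2)^m$; $\hat n(f)=\max_{a\ne0}|\{v\ne0: x\mapsto\langle\hat f_a(x),v\rangle\text{ is constant}\}|$. A permutation $\rho$ maps a partition $\mathcal A$ onto $\mathcal B$ if $\{A\rho:A\in\mathcal A\}=\mathcal B$; a partition is trivial if it is the singleton partition or $\{V\}$. A transitive group is primitive if it preserves no non-trivial partition. *)

theory Defs
  imports Main
begin

text \<open>Vectors of (F_2)^n are represented as functions nat => bool with support below n;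
  True = 1, False = 0 in F_2.  Addition is coordinatewise xor.\<close>

type_synonym vec = "nat \<Rightarrow> bool"

definition Vsp :: "nat \<Rightarrow> vec set" where
  "Vsp n = {v. \<forall>i. n \<le> i \<longrightarrow> \<not> v i}"

definition zero :: vec where "zero = (\<lambda>_. False)"

definition vadd :: "vec \<Rightarrow> vec \<Rightarrow> vec" where
  "vadd v w = (\<lambda>i. v i \<noteq> w i)"

definition transl :: "vec \<Rightarrow> (vec \<Rightarrow> vec)" where
  "transl v = (\<lambda>x. vadd x v)"

definition TV :: "nat \<Rightarrow> (vec \<Rightarrow> vec) set" where
  "TV n = transl ` Vsp n"

definition subgroup_TV :: "nat \<Rightarrow> (vec \<Rightarrow> vec) set \<Rightarrow> bool" where
  "subgroup_TV n T \<longleftrightarrow> T \<subseteq> TV n \<and> id \<in> T \<and>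
     (\<forall>s\<in>T. \<forall>t\<in>T. s \<circ> t \<in> T) \<and> (\<forall>s\<in>T. \<exists>t\<in>T. s \<circ> t = id)"

definition subspace :: "nat \<Rightarrow> vec set \<Rightarrow> bool" where
  "subspace n A \<longleftrightarrow> A \<subseteq> Vsp n \<and> zero \<in> A \<and> (\<forall>x\<in>A. \<forall>y\<in>A. vadd x y \<in> A)"

definition fdim :: "vec set \<Rightarrow> nat" where
  "fdim A = (THE d. card A = 2 ^ d)"

definition GLV :: "nat \<Rightarrow> (vec \<Rightarrow> vec) set" where
  "GLV n = {l. bij_betw l (Vsp n) (Vsp n) \<and> (\<forall>x\<in>Vsp n. \<forall>y\<in>Vsp n. l (vadd x y) = vadd (l x) (l y))}"

text \<open>Block decomposition V = V_0 + ... + V_{b-1} (0-indexed), V_j = coordinates j*m ..< (j+1)*m.\<close>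
definition blk :: "nat \<Rightarrow> nat \<Rightarrow> nat \<Rightarrow> vec set" where
  "blk m b j = {v \<in> Vsp (m*b). \<forall>i. v i \<longrightarrow> i div m = j}"

definition wall :: "nat \<Rightarrow> nat \<Rightarrow> nat set \<Rightarrow> vec set" where
  "wall m b I = {v \<in> Vsp (m*b). \<forall>i. v i \<longrightarrow> i div m \<in> I}"

definition strongly_proper :: "nat \<Rightarrow> nat \<Rightarrow> (vec \<Rightarrow> vec) \<Rightarrow> bool" where
  "strongly_proper m b l \<longleftrightarrow> l \<in> GLV (m*b) \<and>
     (\<forall>I I'. I \<noteq> {} \<longrightarrow> I \<subset> {0..<b} \<longrightarrow> I' \<noteq> {} \<longrightarrow> I' \<subset> {0..<b} \<longrightarrow>
        \<not> (l ` wall m b I \<subseteq> wall m b I'))"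

definition Jset :: "nat \<Rightarrow> nat \<Rightarrow> vec set \<Rightarrow> nat set" where
  "Jset m b U = {j. j < b \<and> blk m b j \<inter> U \<subset> blk m b j}"

definition comp :: "nat \<Rightarrow> nat \<Rightarrow> vec \<Rightarrow> vec" where
  "comp m j v = (\<lambda>i. if i < m then v (j*m + i) else False)"

definition par :: "nat \<Rightarrow> nat \<Rightarrow> (nat \<Rightarrow> vec \<Rightarrow> vec) \<Rightarrow> vec \<Rightarrow> vec" where
  "par m b g v = (\<lambda>i. if i < m*b then g (i div m) (comp m (i div m) v) (i mod m) else False)"

text \<open>encryption: x tau_k = x gamma_1 lambda_1 sigma_{k_1} ... (rounds indexed 1..l)\<close>
fun enc :: "nat \<Rightarrow> nat \<Rightarrow> (nat \<Rightarrow> nat \<Rightarrow> vec \<Rightarrow> vec) \<Rightarrow> (nat \<Rightarrow> vec \<Rightarrow> vec)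
             \<Rightarrow> (nat \<Rightarrow> vec) \<Rightarrow> nat \<Rightarrow> vec \<Rightarrow> vec" where
  "enc m b g lam ks 0 x = x"
| "enc m b g lam ks (Suc r) x =
     vadd (lam (Suc r) (par m b (g (Suc r)) (enc m b g lam ks r x))) (ks (Suc r))"

definition dhat :: "(vec \<Rightarrow> vec) \<Rightarrow> vec \<Rightarrow> vec \<Rightarrow> vec" where
  "dhat f a x = vadd (f (vadd x a)) (f x)"

definition diff_uniform :: "nat \<Rightarrow> (vec \<Rightarrow> vec) \<Rightarrow> nat \<Rightarrow> bool" where
  "diff_uniform m f \<delta> \<longleftrightarrow>
     \<delta> = Max {card {x \<in> Vsp m. dhat f a x = c} | a c. a \<in> Vsp m \<and> a \<noteq> zero \<and> c \<in> Vsp m}"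

definition strongly_anti_invariant :: "nat \<Rightarrow> (vec \<Rightarrow> vec) \<Rightarrow> nat \<Rightarrow> bool" where
  "strongly_anti_invariant m f r \<longleftrightarrow>
     (\<forall>A B. subspace m A \<longrightarrow> subspace m B \<longrightarrow> f ` A = B \<longrightarrow>
        (fdim A = fdim B \<and> fdim A < m - r) \<or> (A = Vsp m \<and> B = Vsp m))"

definition ip :: "nat \<Rightarrow> vec \<Rightarrow> vec \<Rightarrow> bool" where
  "ip m u v = odd (card {i. i < m \<and> u i \<and> v i})"

definition nhat :: "nat \<Rightarrow> (vec \<Rightarrow> vec) \<Rightarrow> nat" where
  "nhat m f = Max ((\<lambda>a. card {v \<in> Vsp m. v \<noteq> zero \<and>
        (\<exists>c. \<forall>x\<in>Vsp m. ip m (dhat f a x) v = c)}) ` (Vsp m - {zero}))"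

definition is_partition :: "vec set \<Rightarrow> vec set set \<Rightarrow> bool" where
  "is_partition S P \<longleftrightarrow> (\<forall>A\<in>P. A \<noteq> {} \<and> A \<subseteq> S) \<and> \<Union>P = S \<and>
     (\<forall>A\<in>P. \<forall>B\<in>P. A \<noteq> B \<longrightarrow> A \<inter> B = {})"

definition trivial_partition :: "vec set \<Rightarrow> vec set set \<Rightarrow> bool" where
  "trivial_partition S P \<longleftrightarrow> P = (\<lambda>x. {x}) ` S \<or> P = {S}"

definition maps_partition :: "(vec \<Rightarrow> vec) \<Rightarrow> vec set set \<Rightarrow> vec set set \<Rightarrow> bool" where
  "maps_partition f P Q \<longleftrightarrow> (\<lambda>A. f ` A) ` P = Q"

definition ext_on :: "vec set \<Rightarrow> (vec \<Rightarrow> vec) \<Rightarrow> vec \<Rightarrow> vec" where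
  "ext_on S f x = (if x \<in> S then f x else x)"

inductive_set gen_group :: "(vec \<Rightarrow> vec) set \<Rightarrow> (vec \<Rightarrow> vec) set" for G where
  gen_id: "id \<in> gen_group G"
| gen_mult: "g \<in> gen_group G \<Longrightarrow> s \<in> G \<Longrightarrow> s \<circ> g \<in> gen_group G"
| gen_inv: "g \<in> gen_group G \<Longrightarrow> s \<in> G \<Longrightarrow> inv s \<circ> g \<in> gen_group G"

definition primitive_on :: "vec set \<Rightarrow> (vec \<Rightarrow> vec) set \<Rightarrow> bool" where
  "primitive_on S Gr \<longleftrightarrow> (\<forall>x\<in>S. \<forall>y\<in>S. \<exists>g\<in>Gr. g x = y) \<and>
     (\<forall>P. is_partition S P \<longrightarrow> (\<forall>g\<in>Gr. maps_partition g P P) \<longrightarrow> trivial_partition S P)"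

end

theory Submission
  imports Defs
begin

text \<open>Varying the three free round keys turns the common pair of partitions into partitions at three
  consecutive key additions that are preserved by \<open>T1\<close>, \<open>T2\<close> and \<open>T3\<close>.  Such a partition may fail to be
  linear, but if \<open>U\<close> is the group of all translations preserving it, of index at most two, then points
  of the same part always differ by an element of \<open>U\<close>; hence within a coset of \<open>U\<close> the parts are
  cosets of one subspace.  Suppose that a parallel map sends such a partition, with translation group \<open>U\<close>, to
  another one, with translation group \<open>U'\<close>, and that each block \<open>V_j\<close> lies in \<open>U\<close> or in \<open>U'\<close>.  If two points
  of one part differ in the component \<open>j\<close>, the S-box hypotheses force \<open>V_j\<close> into \<open>U\<close>, into \<open>U'\<close> and into the
  directions of that part.  It follows that both partitions consist of the cosets of one wall.  This applies to
  the S-box layer of round \<open>i\<close>, and then, since the partition after that round is linear, to the S-box layer of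
  round \<open>i + 1\<close>, so the linear map of round \<open>i\<close> sends a wall to a wall.  For primitivity, the partition into
  orbits is a preserved partition, which gives transitivity.\<close>

section \<open>Linear algebra over the field with two elements\<close>

interpretation vadd: comm_monoid vadd zero
  by unfold_locales (auto simp: vadd_def zero_def fun_eq_iff)

lemmas vadd_ac = vadd.assoc vadd.commute vadd.left_commute

lemma vadd_self [simp]: "vadd x x = zero"
  by (auto simp: vadd_def zero_def)

lemma vadd_self_left [simp]: "vadd x (vadd x y) = y"
  by (auto simp: vadd_def)

lemma vadd_eq_zero [simp]: "vadd x y = zero \<longleftrightarrow> x = y"
  by (auto simp: vadd_def zero_def fun_eq_iff)

lemma vadd_left_cancel [simp]: "vadd x y = vadd x z \<longleftrightarrow> y = z"
  by (auto simp: vadd_def fun_eq_iff)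

lemma vadd_eq_right [simp]: "vadd x y = y \<longleftrightarrow> x = zero"
  by (auto simp: vadd_def zero_def fun_eq_iff)

lemma vadd_eq_left [simp]: "vadd x y = x \<longleftrightarrow> y = zero"
  by (auto simp: vadd_def zero_def fun_eq_iff)

lemma inj_vadd: "inj_on (vadd x) A"
  by (simp add: inj_on_def)

lemma zero_in_Vsp [simp]: "zero \<in> Vsp n"
  by (simp add: Vsp_def zero_def)

lemma vadd_in_Vsp [simp]: "x \<in> Vsp n \<Longrightarrow> y \<in> Vsp n \<Longrightarrow> vadd x y \<in> Vsp n"
  by (auto simp: Vsp_def vadd_def)

lemma Vsp_eq_image: "Vsp n = (\<lambda>X i. i \<in> X) ` Pow {..<n}"
proof (intro equalityI subsetI)
  fix v assume "v \<in> Vsp n"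
  then have "{i. v i} \<subseteq> {..<n}" by (auto simp: Vsp_def not_le[symmetric])
  then show "v \<in> (\<lambda>X i. i \<in> X) ` Pow {..<n}" by (intro image_eqI[of _ _ "{i. v i}"]) auto
qed (auto simp: Vsp_def)

lemma finite_Vsp [simp]: "finite (Vsp n)"
  by (simp add: Vsp_eq_image)

lemma finite_subset_Vsp: "X \<subseteq> Vsp n \<Longrightarrow> finite X"
  by (rule finite_subset) auto

lemma card_Vsp [simp]: "card (Vsp n) = 2 ^ n"
proof -
  have "inj_on (\<lambda>X i. i \<in> X) (Pow {..<n})" by (auto simp: inj_on_def fun_eq_iff)
  then show ?thesis by (simp add: Vsp_eq_image card_image card_Pow)
qed

lemma subspaceD:
  assumes "subspace n A"
  shows "A \<subseteq> Vsp n" "zero \<in> A" "x \<in> A \<Longrightarrow> y \<in> A \<Longrightarrow> vadd x y \<in> A" "finite A"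
  using assms finite_subset[OF _ finite_Vsp] by (auto simp: subspace_def)

text \<open>Over two scalars the span of \<open>A\<close> and \<open>v\<close> is \<open>A\<close>
  together with one further coset, disjoint from it. This lets dimension arguments be carried out
  with orders.\<close>

lemma subspace_extend:
  assumes A: "subspace n A" and v: "v \<in> Vsp n" "v \<notin> A"
  shows "subspace n (A \<union> vadd v ` A)" "card (A \<union> vadd v ` A) = 2 * card A"
proof -
  note A = A subspaceD[OF A]
  have "vadd (vadd v x) y \<in> vadd v ` A" if "x \<in> A" "y \<in> A" for x y
    using that A(4) by (auto simp: vadd.assoc)
  moreover have "vadd x (vadd v y) \<in> vadd v ` A" if "x \<in> A" "y \<in> A" for x y
    using that A(4) by (metis image_eqI vadd.left_commute)
  moreover have "vadd (vadd v x) (vadd v y) \<in> A" if "x \<in> A" "y \<in> A" for x y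
    using that A(4) by (metis vadd.assoc vadd.left_commute vadd_self_left)
  ultimately show "subspace n (A \<union> vadd v ` A)"
    using A v unfolding subspace_def by (auto intro!: vadd_in_Vsp)
  have "A \<inter> vadd v ` A = {}"
  proof (rule ccontr)
    assume "A \<inter> vadd v ` A \<noteq> {}"
    then obtain x y where "x \<in> A" "y \<in> A" "x = vadd v y" by auto
    then have "v = vadd x y" by (simp add: vadd.assoc)
    with \<open>x \<in> A\<close> \<open>y \<in> A\<close> v(2) A(4) show False by auto
  qed
  then show "card (A \<union> vadd v ` A) = 2 * card A"
    using A(5) by (simp add: card_Un_disjoint card_image[OF inj_vadd])
qed

text \<open>In a maximal subspace of \<open>A\<close> whose order is a power of two no vector of
  \<open>A\<close> can be missing, since adjoining it would double the order.\<close>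

lemma subspace_card:
  assumes "subspace n A"
  shows "\<exists>d. card A = 2 ^ d"
proof -
  define Q where "Q B \<longleftrightarrow> subspace n B \<and> B \<subseteq> A \<and> (\<exists>d. card B = 2 ^ d)" for B
  note A = assms subspaceD[OF assms]
  have "Q {zero}" using A by (auto simp: Q_def subspace_def intro!: exI[of _ "0::nat"])
  moreover have "finite {B. Q B}"
    by (rule finite_subset[of _ "Pow A"]) (use A in \<open>auto simp: Q_def\<close>)
  ultimately obtain B where B: "Q B" and mx: "\<And>C. Q C \<Longrightarrow> B \<subseteq> C \<Longrightarrow> C = B"
    using finite_has_maximal[of "{B. Q B}"] by (metis empty_Collect_eq mem_Collect_eq)
  have "B = A"
  proof (rule ccontr)
    assume "B \<noteq> A"
    then obtain v where v: "v \<in> A" "v \<notin> B" using B by (auto simp: Q_def)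
    note e = subspace_extend[of n B v]
    from B obtain d where d: "card B = 2 ^ d" by (auto simp: Q_def)
    have "Q (B \<union> vadd v ` B)"
      using B e v A d by (auto simp: Q_def intro!: exI[of _ "Suc d"])
    from mx[OF this] have "vadd v ` B \<subseteq> B" by blast
    moreover have "zero \<in> B" using B subspaceD(2) by (auto simp: Q_def)
    ultimately have "vadd v zero \<in> B" by blast
    with v show False by simp
  qed
  with B show ?thesis by (simp add: Q_def)
qed

lemma fdim_eq: "card A = 2 ^ d \<Longrightarrow> fdim A = d"
  unfolding fdim_def by (rule the_equality) auto

text \<open>Both sides say that the index is at most two: one outside vector already yields the only
  other coset. The right-hand side involves no counting and passes to larger groups and along linear
  bijections.\<close>

lemma index2_iff:
  assumes A: "subspace n A" and n: "n > 0"
  shows "2 ^ (n - 1) \<le> card A \<longleftrightarrow> (\<forall>u\<in>Vsp n - A. \<forall>v\<in>Vsp n - A. vadd u v \<in> A)"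
proof (cases "A = Vsp n")
  case True
  then show ?thesis by simp
next
  case False
  note A = A subspaceD[OF A]
  from False A obtain u where u: "u \<in> Vsp n" "u \<notin> A" by auto
  note e = subspace_extend[OF A(1) u]
  have two: "(2::nat) ^ n = 2 * 2 ^ (n - 1)" using n by (cases n) auto
  show ?thesis
  proof
    assume le: "2 ^ (n - 1) \<le> card A"
    show "\<forall>u\<in>Vsp n - A. \<forall>v\<in>Vsp n - A. vadd u v \<in> A"
    proof (intro ballI)
      fix u v assume uv: "u \<in> Vsp n - A" "v \<in> Vsp n - A"
      note e = subspace_extend[OF A(1), of u]
      have "A \<union> vadd u ` A = Vsp n"
        by (rule card_seteq) (use uv e le two subspaceD(1) in auto)
      with uv obtain w where "w \<in> A" "v = vadd u w" by blast
      then show "vadd u v \<in> A" by simp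
    qed
  next
    assume *: "\<forall>u\<in>Vsp n - A. \<forall>v\<in>Vsp n - A. vadd u v \<in> A"
    have "Vsp n \<subseteq> A \<union> vadd u ` A"
    proof
      fix v assume "v \<in> Vsp n"
      then have "v \<in> A \<or> vadd u v \<in> A" using * u by auto
      then show "v \<in> A \<union> vadd u ` A" by (metis UnI1 UnI2 image_eqI vadd_self_left)
    qed
    from card_mono[OF _ this] e two A show "2 ^ (n - 1) \<le> card A" by simp
  qed
qed

lemma card_hyperplane:
  assumes A: "subspace n A" and n: "n > 0" "A \<noteq> Vsp n" and c: "2 ^ (n - 1) \<le> card A"
  shows "card A = 2 ^ (n - 1)"
proof -
  obtain d where d: "card A = 2 ^ d" using subspace_card[OF A] by auto
  have "card A < 2 ^ n"
    using psubset_card_mono[of "Vsp n" A] n subspaceD(1)[OF A] by auto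
  then show ?thesis using c n d by (auto simp: power_strict_increasing_iff intro: antisym)
qed

section \<open>The standard bilinear form and annihilators\<close>

lemma ip_Suc: "ip (Suc m) u v \<longleftrightarrow> (ip m u v \<noteq> (u m \<and> v m))"
proof -
  have "{i. i < Suc m \<and> u i \<and> v i} = (if u m \<and> v m then insert m {i. i < m \<and> u i \<and> v i} else {i. i < m \<and> u i \<and> v i})"
    by (auto simp: less_Suc_eq)
  then show ?thesis by (simp add: ip_def)
qed

lemma ip_0 [simp]: "\<not> ip 0 u v"
  by (simp add: ip_def)

lemma ip_vadd: "ip m (vadd u w) v \<longleftrightarrow> (ip m u v \<noteq> ip m w v)"
  by (induction m) (auto simp: ip_Suc vadd_def)

lemma ip_cong: "(\<And>i. i < m \<Longrightarrow> v i = v' i) \<Longrightarrow> ip m u v = ip m u v'"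
  by (simp add: ip_def cong: conj_cong)

text \<open>Nondegeneracy of the form, by induction on the number of coordinates through the slice
  \<open>B0\<close> of vectors with last coordinate zero.\<close>

lemma ex_annihilator:
  assumes "subspace m B" "B \<noteq> Vsp m"
  shows "\<exists>v\<in>Vsp m. v \<noteq> zero \<and> (\<forall>u\<in>B. \<not> ip m u v)"
  using assms
proof (induction m arbitrary: B)
  case 0
  have "Vsp 0 = {zero}" by (auto simp: Vsp_def zero_def fun_eq_iff)
  with 0 subspaceD(1,2)[OF 0(1)] show ?case by auto
next
  case (Suc m)
  note B = subspaceD[OF Suc.prems(1)]
  define B0 where "B0 = {v \<in> B. \<not> v m}"
  have V: "x \<in> Vsp m \<longleftrightarrow> x \<in> Vsp (Suc m) \<and> \<not> x m" for x
    by (auto simp: Vsp_def) (metis le_antisym not_less_eq_eq)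
  have B0: "subspace m B0"
    using B V by (auto simp: subspace_def B0_def vadd_def zero_def)
  show ?case
  proof (cases "B0 = Vsp m")
    case True
    \<comment> \<open>Together with a full slice, a vector of \<open>B\<close> with last coordinate
      one would generate everything. So the last coordinate vanishes on \<open>B\<close> and is the
      functional sought.\<close>
    have no: "\<not> e m" if "e \<in> B" for e
    proof
      assume "e m"
      have "x \<in> B" if x: "x \<in> Vsp (Suc m)" for x
      proof (cases "x m")
        case False
        with x V[of x] have "x \<in> B0" unfolding True by blast
        then show ?thesis by (simp add: B0_def)
      next
        case t: True
        have "vadd e x \<in> Vsp (Suc m)" using x \<open>e \<in> B\<close> B(1) by auto
        moreover have "\<not> vadd e x m" using t \<open>e m\<close> by (simp add: vadd_def)
        ultimately have "vadd e x \<in> B0" using V True by simp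
        then have "vadd e (vadd e x) \<in> B" using B(3)[of e "vadd e x"] \<open>e \<in> B\<close> unfolding B0_def by blast
        then show ?thesis by simp
      qed
      with B(1) Suc.prems(2) show False by auto
    qed
    have "(\<lambda>i. i = m) \<in> Vsp (Suc m)" "(\<lambda>i. i = m) \<noteq> zero"
      by (auto simp: Vsp_def zero_def fun_eq_iff)
    moreover have "\<not> ip (Suc m) u (\<lambda>i. i = m)" if "u \<in> B" for u
      using no[OF that] by (auto simp: ip_def less_Suc_eq cong: conj_cong)
    ultimately show ?thesis by blast
  next
    case False
    from Suc.IH[OF B0 False] obtain v where v: "v \<in> Vsp m" "v \<noteq> zero" "\<And>u. u \<in> B0 \<Longrightarrow> \<not> ip m u v"
      by auto
    \<comment> \<open>The last coordinate of \<open>w\<close> has to cancel \<open>ip m e v\<close>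
      on vectors of \<open>B\<close> outside the slice. That value does not depend on
      \<open>e\<close>, as two such vectors differ by an element of \<open>B0\<close>.\<close>
    define w where "w = v(m := (\<exists>e\<in>B. e m \<and> ip m e v))"
    have ipw: "ip m u w = ip m u v" for u by (rule ip_cong) (simp add: w_def)
    have "w \<in> Vsp (Suc m)" using v(1) by (auto simp: w_def Vsp_def)
    moreover have "w \<noteq> zero"
      using v(1,2) by (auto simp: w_def zero_def Vsp_def fun_eq_iff)
    moreover have "\<not> ip (Suc m) u w" if u: "u \<in> B" for u
    proof (cases "u m")
      case False
      with u v(3) show ?thesis by (simp add: ip_Suc ipw B0_def)
    next
      case True
      have "ip m e v = ip m u v" if "e \<in> B" "e m" for e
      proof -
        have "vadd e u \<in> B0" using that u True B(3) by (auto simp: B0_def vadd_def)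
        from v(3)[OF this] show ?thesis by (simp add: ip_vadd)
      qed
      with u True have "(\<exists>e\<in>B. e m \<and> ip m e v) = ip m u v" by blast
      then have "w m = ip m u v" by (simp add: w_def)
      then show ?thesis using True by (simp add: ip_Suc ipw)
    qed
    ultimately show ?thesis by blast
  qed
qed

section \<open>Fibres and images of derivatives\<close>

lemma card_le_fibres:
  assumes "finite Y" "f ` X \<subseteq> Y" "\<And>y. y \<in> Y \<Longrightarrow> card {x \<in> X. f x = y} \<le> k"
  shows "card X \<le> card Y * k"
proof -
  have "X = (\<Union>y\<in>Y. {x \<in> X. f x = y})" using assms(2) by auto
  then have "card X = card (\<Union>y\<in>Y. {x \<in> X. f x = y})" by (rule arg_cong)
  also have "\<dots> \<le> (\<Sum>y\<in>Y. card {x \<in> X. f x = y})" by (rule card_UN_le[OF assms(1)])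
  also have "\<dots> \<le> card Y * k" using sum_bounded_above[of Y _ k] assms(3) by simp
  finally show ?thesis .
qed

lemma diff_uniformD:
  assumes "diff_uniform m f \<delta>" "a \<in> Vsp m" "a \<noteq> zero" "c \<in> Vsp m"
  shows "card {x \<in> Vsp m. dhat f a x = c} \<le> \<delta>"
proof -
  define N where "N a c = card {x \<in> Vsp m. dhat f a x = c}" for a c
  define S where "S = {N a c | a c. a \<in> Vsp m \<and> a \<noteq> zero \<and> c \<in> Vsp m}"
  have "S \<subseteq> case_prod N ` (Vsp m \<times> Vsp m)"
    unfolding S_def by fast
  then have "finite S"
    by (rule finite_subset) simp
  moreover have "N a c \<in> S"
    unfolding S_def using assms(2-4) by blast
  ultimately have "N a c \<le> Max S" by (rule Max_ge)
  moreover have "\<delta> = Max S"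
    using assms(1) unfolding diff_uniform_def S_def N_def .
  ultimately show ?thesis by (simp only: N_def)
qed

text \<open>A nonzero annihilator of a proper \<open>B\<close> would make a component of the
  derivative constant, with value \<open>ip m c v\<close>, and would be counted by
  \<open>nhat\<close>.\<close>

lemma nhat_zeroD:
  assumes "nhat m f = 0" "a \<in> Vsp m" "a \<noteq> zero" "subspace m B"
    and sub: "\<And>x. x \<in> Vsp m \<Longrightarrow> vadd (dhat f a x) c \<in> B"
  shows "B = Vsp m"
proof (rule ccontr)
  assume "B \<noteq> Vsp m"
  from ex_annihilator[OF assms(4) this] obtain v
    where v: "v \<in> Vsp m" "v \<noteq> zero" "\<And>u. u \<in> B \<Longrightarrow> \<not> ip m u v" by auto
  let ?S = "\<lambda>a. {v \<in> Vsp m. v \<noteq> zero \<and> (\<exists>c. \<forall>x\<in>Vsp m. ip m (dhat f a x) v = c)}"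
  have "card (?S a) \<le> nhat m f"
    unfolding nhat_def using assms(2,3) by (intro Max_ge) auto
  then have "?S a = {}" using assms(1) by simp
  moreover have "ip m (dhat f a x) v = ip m c v" if "x \<in> Vsp m" for x
    using v(3)[OF sub[OF that]] by (simp add: ip_vadd)
  ultimately show False using v(1,2) by blast
qed

section \<open>S-boxes\<close>

text \<open>Hypotheses (1) and (2), with the exact maximum relaxed to a bound and dimensions
  replaced by orders. For a bijection this form is symmetric under inversion.\<close>

definition anti_inv_sbox :: "nat \<Rightarrow> (vec \<Rightarrow> vec) \<Rightarrow> bool" where
  "anti_inv_sbox m f \<longleftrightarrow> (\<exists>r. r < m - 1
     \<and> (\<forall>a\<in>Vsp m. \<forall>c\<in>Vsp m. a \<noteq> zero \<longrightarrow> card {x \<in> Vsp m. dhat f a x = c} \<le> 2 ^ r)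
     \<and> (\<forall>A B. subspace m A \<longrightarrow> subspace m B \<longrightarrow> f ` A = B \<longrightarrow> card B < 2 ^ (m - r) \<or> B = Vsp m))"

text \<open>The second clause expresses \<open>nhat m f = 0\<close> by duality: no derivative of \<open>f\<close> has its image in a
  proper affine subspace.\<close>

definition spanning_sbox :: "nat \<Rightarrow> (vec \<Rightarrow> vec) \<Rightarrow> bool" where
  "spanning_sbox m f \<longleftrightarrow>
     (\<forall>a\<in>Vsp m. \<forall>c\<in>Vsp m. a \<noteq> zero \<longrightarrow> card {x \<in> Vsp m. dhat f a x = c} \<le> 4)
     \<and> (\<forall>a\<in>Vsp m. \<forall>B c. a \<noteq> zero \<longrightarrow> subspace m B \<longrightarrow>
           (\<forall>x\<in>Vsp m. vadd (dhat f a x) c \<in> B) \<longrightarrow> B = Vsp m)"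

lemma anti_inv_sboxI:
  assumes "r < m - 1" "diff_uniform m f (2 ^ r)" "strongly_anti_invariant m f r"
  shows "anti_inv_sbox m f"
  unfolding anti_inv_sbox_def
proof (intro exI[of _ r] conjI allI impI ballI)
  fix A B assume A: "subspace m A" and B: "subspace m B" and f: "f ` A = B"
  obtain d where d: "card B = 2 ^ d" using subspace_card[OF B] by auto
  from assms(3) A B f have "fdim B < m - r \<or> B = Vsp m"
    unfolding strongly_anti_invariant_def by metis
  then show "card B < 2 ^ (m - r) \<or> B = Vsp m"
    using fdim_eq[OF d] d by auto
qed (use assms diff_uniformD in auto)

lemma spanning_sboxI:
  assumes "diff_uniform m f 4" "nhat m f = 0"
  shows "spanning_sbox m f"
  unfolding spanning_sbox_def using diff_uniformD[OF assms(1)] nhat_zeroD[OF assms(2)] by blast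

text \<open>The inverse sends a solution of its own derivative equation with direction
  \<open>a\<close> and value \<open>c\<close> to a solution for \<open>f\<close> with
  \<open>a\<close> and \<open>c\<close> exchanged. A pair of subspaces is simply swapped.\<close>

lemma anti_inv_sbox_inv:
  assumes f: "bij_betw f (Vsp m) (Vsp m)" and "anti_inv_sbox m f"
  shows "anti_inv_sbox m (inv_into (Vsp m) f)"
proof -
  let ?F = "inv_into (Vsp m) f"
  obtain r where r: "r < m - 1"
      and "\<forall>a\<in>Vsp m. \<forall>c\<in>Vsp m. a \<noteq> zero \<longrightarrow> card {x \<in> Vsp m. dhat f a x = c} \<le> 2 ^ r"
      and "\<forall>A B. subspace m A \<longrightarrow> subspace m B \<longrightarrow> f ` A = B \<longrightarrow> card B < 2 ^ (m - r) \<or> B = Vsp m"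
      using assms(2) unfolding anti_inv_sbox_def by (elim exE conjE)
    note du = this(2)[rule_format] and ai = this(3)[rule_format]
  have F: "bij_betw ?F (Vsp m) (Vsp m)" by (rule bij_betw_inv_into[OF f])
  note fV = bij_betw_apply[OF f] bij_betw_apply[OF F]
    bij_betw_inv_into_right[OF f] bij_betw_inv_into_left[OF f]
  show ?thesis
    unfolding anti_inv_sbox_def
  proof (intro exI[of _ r] conjI allI impI ballI r)
    fix a c assume ac: "a \<in> Vsp m" "c \<in> Vsp m" "a \<noteq> zero"
    let ?S = "{x \<in> Vsp m. dhat ?F a x = c}" and ?T = "{x \<in> Vsp m. dhat f c x = a}"
    show "card ?S \<le> 2 ^ r"
    proof (cases "c = zero")
      \<comment> \<open>Value zero would become direction zero, where the bound says nothing;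
        injectivity excludes any solution.\<close>
      case True
      have "?S = {}"
      proof (rule equals0I)
        fix x assume "x \<in> ?S"
        then have x: "x \<in> Vsp m" "dhat ?F a x = c" by auto
        then have "?F (vadd x a) = ?F x" by (simp add: dhat_def True)
        then have "f (?F (vadd x a)) = f (?F x)" by simp
        with x ac show False by (simp add: fV)
      qed
      then have "card ?S = card ({} :: vec set)" by (rule arg_cong)
      then show ?thesis by (simp only: card.empty le0)
    next
      case False
      have "?F ` ?S \<subseteq> ?T"
      proof clarify
        fix x assume x: "x \<in> Vsp m" "c = dhat ?F a x"
        then have "vadd (?F x) c = ?F (vadd x a)" by (simp add: dhat_def vadd_ac)
        then have "dhat f c (?F x) = a" using x ac
          by (simp add: dhat_def fV vadd_ac)
        then show "?F x \<in> Vsp m \<and> dhat f (dhat ?F a x) (?F x) = a" using x fV by simp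
      qed
      moreover have "inj_on ?F ?S" using F by (auto simp: bij_betw_def inj_on_def)
      ultimately have "card ?S \<le> card ?T" by (intro card_inj_on_le) auto
      with du[OF ac(2,1) False] show ?thesis by simp
    qed
  next
    fix A B assume A: "subspace m A" and B: "subspace m B" and FA: "?F ` A = B"
    have "f ` B = A" using subspaceD(1)[OF A] fV unfolding FA[symmetric] by (force simp: image_image)
    from ai[OF B A this] have "card A < 2 ^ (m - r) \<or> A = Vsp m" .
    moreover have "card B = card A"
      unfolding FA[symmetric]
      by (rule card_image) (use F subspaceD(1)[OF A] in \<open>auto simp: bij_betw_def inj_on_def\<close>)
    moreover have "B = Vsp m" if "A = Vsp m" using that FA F by (simp add: bij_betw_def)
    ultimately show "card B < 2 ^ (m - r) \<or> B = Vsp m" by auto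
  qed
qed

text \<open>By counting, \<open>X\<close> consists of at most two cosets of \<open>B\<close>, and
  over two scalars two cosets of \<open>B\<close> together form a coset of a larger
  subspace.\<close>

lemma coset_of_hyperplane:
  assumes B: "subspace m B" and m: "m > 0" and X: "X \<subseteq> Vsp m" "card X = 2 ^ (m - 1)"
    and cl: "\<And>x b. x \<in> X \<Longrightarrow> b \<in> B \<Longrightarrow> vadd x b \<in> X"
    and big: "2 ^ (m - 1) \<le> 2 * card B" and y: "y \<in> X"
  shows "\<exists>C. subspace m C \<and> card C = 2 ^ (m - 1) \<and> X = vadd y ` C"
proof -
  have fX: "finite X" using X(1) finite_subset_Vsp by auto
  have sub: "vadd y ` B \<subseteq> X" using cl y by auto
  show ?thesis
  proof (cases "X = vadd y ` B")
    case True
    with X(2) B show ?thesis by (auto simp: card_image[OF inj_vadd])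
  next
    case False
    with sub obtain z where z: "z \<in> X" "z \<notin> vadd y ` B" by auto
    define v where "v = vadd y z"
    have v: "v \<in> Vsp m" "v \<notin> B"
    proof -
      show "v \<in> Vsp m" using X(1) y z(1) unfolding v_def by (intro vadd_in_Vsp) auto
      show "v \<notin> B" using z(2) by (metis image_eqI v_def vadd_self_left)
    qed
    note e = subspace_extend[OF B v]
    have "vadd y (vadd v b) \<in> X" if "b \<in> B" for b
      using cl[OF z(1) that] by (simp add: v_def vadd.assoc)
    with sub have s: "vadd y ` (B \<union> vadd v ` B) \<subseteq> X" by auto
    then have "card (B \<union> vadd v ` B) \<le> card X"
      using card_mono[OF fX s] by (simp add: card_image[OF inj_vadd])
    then have c: "card (B \<union> vadd v ` B) = card X" using e big X by simp
    then have "vadd y ` (B \<union> vadd v ` B) = X"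
      by (intro card_subset_eq fX s) (simp add: card_image[OF inj_vadd])
    with e(1) c X(2) show ?thesis by metis
  qed
qed

text \<open>The preimage of a coset of the hyperplane \<open>C\<close> is invariant under
  translation by \<open>a\<close>. So \<open>f x\<close> and \<open>f (vadd x a)\<close> lie on the
  same side of \<open>C\<close>, and all values of the derivative fall into \<open>C\<close>,
  contrary to spanning.\<close>

lemma dhat_not_hyperplane:
  assumes f: "bij_betw f (Vsp m) (Vsp m)" and n: "spanning_sbox m f"
    and H: "subspace m H" and s0: "s0 \<in> Vsp m" and a: "a \<in> H" "a \<noteq> zero"
    and C: "subspace m C" "card C = 2 ^ (m - 1)" and m: "m > 0"
    and img: "f ` vadd s0 ` H = vadd (f s0) ` C"
  shows False
proof -
  have aV: "a \<in> Vsp m" using H a subspaceD(1) by auto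
  note fV = bij_betw_apply[OF f]
  have ne: "C \<noteq> Vsp m" using C(2) m by (cases m) auto
  have i2: "vadd u v \<in> C" if "u \<in> Vsp m - C" "v \<in> Vsp m - C" for u v
    using index2_iff[OF C(1) m] C(2) that by simp
  have iff: "x \<in> vadd s0 ` H \<longleftrightarrow> vadd (f s0) (f x) \<in> C" if "x \<in> Vsp m" for x
  proof -
    have HV: "vadd s0 ` H \<subseteq> Vsp m" using s0 subspaceD(1)[OF H] by auto
    have "x \<in> vadd s0 ` H \<longleftrightarrow> f x \<in> f ` vadd s0 ` H"
      using inj_on_image_mem_iff[OF bij_betw_imp_inj_on[OF f] that HV] by simp
    also have "\<dots> \<longleftrightarrow> vadd (f s0) (f x) \<in> C"
      unfolding img by (metis imageE image_eqI vadd_self_left)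
    finally show ?thesis .
  qed
  have memH: "x \<in> vadd s0 ` H \<longleftrightarrow> vadd s0 x \<in> H" for x
    by (metis imageE image_eqI vadd_self_left)
  have "vadd (dhat f a x) zero \<in> C" if x: "x \<in> Vsp m" for x
  proof -
    have "vadd s0 x \<in> H \<longleftrightarrow> vadd s0 (vadd x a) \<in> H"
      using subspaceD(3)[OF H _ a(1)] by (metis vadd.assoc vadd_self vadd.right_neutral)
    then have *: "vadd (f s0) (f x) \<in> C \<longleftrightarrow> vadd (f s0) (f (vadd x a)) \<in> C"
      using iff memH x aV by auto
    have "dhat f a x = vadd (vadd (f s0) (f x)) (vadd (f s0) (f (vadd x a)))"
      by (simp add: dhat_def vadd_ac)
    with * i2 subspaceD(3)[OF C(1)] x s0 aV fV show ?thesis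
      by (metis DiffI vadd_in_Vsp vadd.right_neutral)
  qed
  with n aV a(2) C(1) ne show False unfolding spanning_sbox_def by blast
qed

text \<open>Here \<open>H\<close> and \<open>B\<close> are the traces on one block of the translation groups of the partition before the
  S-boxes and of the part after them.  If \<open>H\<close> is a hyperplane and \<open>B \<noteq> Vsp m\<close>, a nonzero element of \<open>B\<close>
  yields a derivative that maps \<open>H\<close> into \<open>B - {zero}\<close>; leaving out \<open>zero\<close> is what doubles the lower
  bound on the power of two \<open>card B\<close>.\<close>

lemma sbox_full:
  assumes f: "bij_betw f (Vsp m) (Vsp m)" "f zero = zero" and m: "m > 1"
    and sb: "anti_inv_sbox m f \<or> spanning_sbox m f"
    and H: "subspace m H" "2 ^ (m - 1) \<le> card H" and B: "subspace m B"
    and c1: "\<And>s t. s \<in> Vsp m \<Longrightarrow> t \<in> Vsp m \<Longrightarrow> vadd (f s) (f t) \<in> B \<Longrightarrow> vadd s t \<in> H"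
    and c2: "\<And>s t h. s \<in> Vsp m \<Longrightarrow> t \<in> Vsp m \<Longrightarrow> vadd (f s) (f t) \<in> B \<Longrightarrow> h \<in> H \<Longrightarrow>
               vadd (f (vadd s h)) (f (vadd t h)) \<in> B"
    and a: "a \<in> Vsp m" "a \<noteq> zero" and s0: "s0 \<in> Vsp m"
    and c3: "\<And>h. h \<in> H \<Longrightarrow> vadd (dhat f a (vadd s0 h)) (dhat f a s0) \<in> B"
  shows "B = Vsp m"
proof (rule ccontr)
  assume nB: "B \<noteq> Vsp m"
  note HD = subspaceD[OF H(1)] and BD = subspaceD[OF B]
  have m0: "m > 0" using m by simp
  note fV = bij_betw_apply[OF f(1)]
  have fi: "f x = f y \<longleftrightarrow> x = y" if "x \<in> Vsp m" "y \<in> Vsp m" for x y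
    using f that by (auto simp: bij_betw_def inj_on_def)
  have dV: "dhat f a x \<in> Vsp m" if "x \<in> Vsp m" "a \<in> Vsp m" for a x
    using that fV by (simp add: dhat_def)
  obtain d where d: "card B = 2 ^ d" using subspace_card[OF B] by auto
  have i2: "vadd u v \<in> H" if "u \<in> Vsp m - H" "v \<in> Vsp m - H" for u v
    using index2_iff[OF H(1) m0] H(2) that by simp
  have cnt: "card X \<le> card Y * k"
    if "\<And>c. c \<in> Vsp m \<Longrightarrow> card {x \<in> Vsp m. dhat f a x = c} \<le> k"
      "X \<subseteq> Vsp m" "Y \<subseteq> Vsp m" "\<And>x. x \<in> X \<Longrightarrow> dhat f a x \<in> Y" for a k X Y
  proof (rule card_le_fibres[of Y "dhat f a"])
    show "finite Y" using that(3) finite_subset_Vsp by auto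
    fix y assume "y \<in> Y"
    have "card {x \<in> X. dhat f a x = y} \<le> card {x \<in> Vsp m. dhat f a x = y}"
      by (rule card_mono) (use that(2) in auto)
    with that(1)[of y] that(3) \<open>y \<in> Y\<close> show "card {x \<in> X. dhat f a x = y} \<le> k" by fastforce
  qed (use that in auto)
  \<comment> \<open>The preimage of \<open>B\<close> is a subspace, so anti-invariance bounds
    \<open>B\<close>: \<open>c1\<close> against \<open>zero\<close> puts \<open>s\<close> into
    \<open>H\<close>, and \<open>c2\<close> then translates the pair \<open>t\<close>,
    \<open>zero\<close> by \<open>s\<close>.\<close>
  have card_B: "card B < 2 ^ (m - r)"
    if "\<And>A B. subspace m A \<Longrightarrow> subspace m B \<Longrightarrow> f ` A = B \<Longrightarrow> card B < 2 ^ (m - r) \<or> B = Vsp m" for r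
  proof -
    define A where "A = {s \<in> Vsp m. f s \<in> B}"
    have "vadd s t \<in> A" if "s \<in> A" "t \<in> A" for s t
    proof -
      have st: "s \<in> Vsp m" "t \<in> Vsp m" "f s \<in> B" "f t \<in> B" using that by (auto simp: A_def)
      have "s \<in> H" using c1[of s zero] st by (simp add: f)
      from c2[of t zero s] st this have "vadd (f (vadd s t)) (f s) \<in> B"
        by (simp add: f vadd.commute)
      from BD(3)[OF this st(3)] have "f (vadd s t) \<in> B" by (simp add: vadd.assoc)
      with st show ?thesis by (simp add: A_def)
    qed
    then have "subspace m A" using BD f by (auto simp: subspace_def A_def)
    moreover have "f ` A = B"
      using BD(1) f(1) unfolding A_def bij_betw_def by (auto simp: subset_eq image_iff)
    ultimately show ?thesis using that nB B by blast
  qed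
  have Hcos: "vadd s0 ` H \<subseteq> Vsp m" "card (vadd s0 ` H) = card H"
    using s0 HD by (auto simp: card_image[OF inj_vadd])
  have dB: "dhat f a x \<in> vadd (dhat f a s0) ` B" if "x \<in> vadd s0 ` H" for x
    using that c3 by (auto simp: image_iff) (metis vadd.commute vadd_self_left)
  have DB: "vadd (dhat f a s0) ` B \<subseteq> Vsp m" "card (vadd (dhat f a s0) ` B) = card B"
    using dV[OF s0 a(1)] BD by (auto simp: card_image[OF inj_vadd])
  show False
  proof (cases "a \<in> H \<and> H \<noteq> Vsp m")
    case False
    \<comment> \<open>If \<open>H\<close> is everything or misses \<open>a\<close>, control of the
      derivative on the coset of \<open>H\<close> through \<open>s0\<close> extends to all points: a
      point outside is moved into the coset by \<open>a\<close>, and the derivative agrees at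
      both.\<close>
    have all: "dhat f a x \<in> vadd (dhat f a s0) ` B" if x: "x \<in> Vsp m" for x
    proof (cases "vadd s0 x \<in> H")
      case True
      then show ?thesis using dB[of x] by (metis image_eqI vadd_self_left)
    next
      case nH: False
      with False x s0 have "a \<notin> H" by auto
      with i2[of "vadd s0 x" a] nH x s0 a have "vadd s0 (vadd x a) \<in> H"
        by (simp add: vadd.assoc)
      then have "vadd x a \<in> vadd s0 ` H" by (metis image_eqI vadd_self_left)
      from dB[OF this] show ?thesis by (simp add: dhat_def vadd_ac)
    qed
    from sb show False
    proof
      assume "anti_inv_sbox m f"
      then obtain r where r: "r < m - 1"
      and "\<forall>a\<in>Vsp m. \<forall>c\<in>Vsp m. a \<noteq> zero \<longrightarrow> card {x \<in> Vsp m. dhat f a x = c} \<le> 2 ^ r"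
      and "\<forall>A B. subspace m A \<longrightarrow> subspace m B \<longrightarrow> f ` A = B \<longrightarrow> card B < 2 ^ (m - r) \<or> B = Vsp m"
        unfolding anti_inv_sbox_def by (elim exE conjE)
      note du = this(2)[rule_format] and ai = this(3)[rule_format]
      have "2 ^ m \<le> card B * 2 ^ r"
        using cnt[of a "2 ^ r" "Vsp m" "vadd (dhat f a s0) ` B"] du a all DB by simp
      moreover have "card B * 2 ^ r < 2 ^ (m - r) * 2 ^ r" using card_B[OF ai] by simp
      moreover have "2 ^ (m - r) * 2 ^ r = (2::nat) ^ m" using r by (simp flip: power_add)
      ultimately show False by simp
    next
      assume "spanning_sbox m f"
      moreover have "vadd (dhat f a x) (dhat f a s0) \<in> B" if "x \<in> Vsp m" for x
        using all[OF that] by (auto simp: vadd_ac)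
      ultimately have "B = Vsp m" using a B unfolding spanning_sbox_def by blast
      with nB show False by simp
    qed
  next
    case True
    have cH: "card H = 2 ^ (m - 1)" using card_hyperplane[OF H(1) m0 _ H(2)] True by simp
    have cnt1: "2 ^ (m - 1) \<le> card B * k"
      if "\<And>c. c \<in> Vsp m \<Longrightarrow> card {x \<in> Vsp m. dhat f a x = c} \<le> k" for k
      using cnt[of a k "vadd s0 ` H" "vadd (dhat f a s0) ` B"] that Hcos DB dB cH by simp
    have cnt2: "2 ^ (m - 1) \<le> (card B - 1) * k"
      if b0: "B \<noteq> {zero}"
        and k: "\<And>a c. a \<in> Vsp m \<Longrightarrow> c \<in> Vsp m \<Longrightarrow> a \<noteq> zero \<Longrightarrow> card {x \<in> Vsp m. dhat f a x = c} \<le> k" for k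
    proof -
      from b0 BD obtain b where b: "b \<in> B" "b \<noteq> zero" by blast
      have "b \<in> f ` Vsp m" using b BD f by (auto simp: bij_betw_def)
      then obtain a1 where a1: "a1 \<in> Vsp m" "f a1 = b" by auto
      have "a1 \<noteq> zero" using a1 b f by auto
      have "dhat f a1 h \<in> B - {zero}" if h: "h \<in> H" for h
        using c2[of a1 zero h] a1 b h HD(1) fi[of "vadd h a1" h] \<open>a1 \<noteq> zero\<close>
        by (auto simp: f dhat_def vadd.commute)
      then have "card H \<le> card (B - {zero}) * k"
        using a1 k \<open>a1 \<noteq> zero\<close> HD BD by (intro cnt[of a1]) auto
      then show ?thesis using cH BD by simp
    qed
    from sb show False
    proof
      assume "anti_inv_sbox m f"
      then obtain r where r: "r < m - 1"
      and "\<forall>a\<in>Vsp m. \<forall>c\<in>Vsp m. a \<noteq> zero \<longrightarrow> card {x \<in> Vsp m. dhat f a x = c} \<le> 2 ^ r"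
      and "\<forall>A B. subspace m A \<longrightarrow> subspace m B \<longrightarrow> f ` A = B \<longrightarrow> card B < 2 ^ (m - r) \<or> B = Vsp m"
        unfolding anti_inv_sbox_def by (elim exE conjE)
      note du = this(2)[rule_format] and ai = this(3)[rule_format]
      have split: "(2::nat) ^ (m - 1) = 2 ^ (m - 1 - r) * 2 ^ r" using r by (simp flip: power_add)
      \<comment> \<open>With \<open>B\<close> zero the derivative would be constant on a coset of
        \<open>H\<close>, giving a fibre of size \<open>2 ^ (m - 1)\<close>, larger than
        \<open>2 ^ r\<close>.\<close>
      have "B \<noteq> {zero}"
      proof
        assume "B = {zero}"
        with cnt1[OF du[OF a(1) _ a(2)]] have "(2::nat) ^ (m - 1) \<le> 2 ^ r" by simp
        then show False using r by (simp add: power_le_imp_le_exp leD)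
      qed
      from cnt2[OF this du] have "2 ^ (m - 1 - r) \<le> card B - 1" unfolding split by simp
      then have "(2::nat) ^ (m - 1 - r) < 2 ^ d" using d by (cases "2 ^ d :: nat") auto
      then have "m - 1 - r < d" by simp
      then have "(2::nat) ^ (m - r) \<le> card B" unfolding d by (intro power_increasing) auto
      with card_B[OF ai] show False by simp
    next
      assume n: "spanning_sbox m f"
      have du: "card {x \<in> Vsp m. dhat f a x = c} \<le> 4" if "a \<in> Vsp m" "c \<in> Vsp m" "a \<noteq> zero" for a c
        using n that unfolding spanning_sbox_def by blast
      \<comment> \<open>The aim is that the image of the coset is a coset of a hyperplane, which
        \<open>dhat_not_hyperplane\<close> forbids. For this, \<open>X\<close> is closed under a
        subspace of at least half its order.\<close>
      define X where "X = f ` vadd s0 ` H"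
      have X: "X \<subseteq> Vsp m" "card X = 2 ^ (m - 1)" "f s0 \<in> X"
      proof -
        show "X \<subseteq> Vsp m" using Hcos fV by (auto simp: X_def)
        show "card X = 2 ^ (m - 1)"
          using card_image[OF inj_on_subset[OF bij_betw_imp_inj_on[OF f(1)] Hcos(1)]] Hcos(2) cH
          by (simp add: X_def)
        show "f s0 \<in> X" unfolding X_def using HD(2) by (metis image_eqI vadd.right_neutral)
      qed
      have "\<exists>C. subspace m C \<and> card C = 2 ^ (m - 1) \<and> X = vadd (f s0) ` C"
      proof (cases "B = {zero}")
        case B0: True
        \<comment> \<open>The derivative is now constantly \<open>c\<close> on the coset, which
          \<open>a\<close> preserves, so \<open>X\<close> is closed under adding \<open>c\<close>.
          The coset is a single fibre of at most four points, twice the order of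
          \<open>{zero, c}\<close>.\<close>
        define c where "c = dhat f a s0"
        have c: "c \<in> Vsp m" "c \<noteq> zero"
          using a s0 fi[of "vadd s0 a" s0] dV by (auto simp: c_def dhat_def)
        have "subspace m {zero, c}" using c by (auto simp: subspace_def)
        moreover have "vadd x b \<in> X" if "x \<in> X" "b \<in> {zero, c}" for x b
        proof -
          from \<open>x \<in> X\<close> obtain h where h: "h \<in> H" "x = f (vadd s0 h)" by (auto simp: X_def)
          have "dhat f a (vadd s0 h) = c" using c3[OF h(1)] B0 by (simp add: c_def)
          then have "vadd x c = f (vadd s0 (vadd h a))" using h by (auto simp: dhat_def vadd_ac)
          moreover have "vadd h a \<in> H" using HD(3) h(1) True by simp
          ultimately have "vadd x c \<in> X" by (auto simp: X_def)
          then show ?thesis using that by auto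
        qed
        moreover have "(2::nat) ^ (m - 1) \<le> 2 * card {zero, c}"
          using cnt1[OF du[OF a(1) _ a(2)]] c B0 by simp
        ultimately show ?thesis using X m0 by (intro coset_of_hyperplane[of m "{zero, c}"])
      next
        case False
        have "vadd x b \<in> X" if "x \<in> X" "b \<in> B" for x b
        proof -
          from \<open>x \<in> X\<close> obtain h where h: "h \<in> H" "x = f (vadd s0 h)" by (auto simp: X_def)
          have s: "vadd s0 h \<in> Vsp m" using h s0 HD by auto
          have "vadd x b \<in> Vsp m" using X(1) BD(1) that by (intro vadd_in_Vsp) auto
          then have "vadd x b \<in> f ` Vsp m" using f by (simp add: bij_betw_def)
          then obtain t where t: "t \<in> Vsp m" "f t = vadd x b" by auto
          have "vadd (vadd s0 h) t \<in> H" using c1[OF s t(1)] t h that by simp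
          from HD(3)[OF h(1) this] have "vadd s0 t \<in> H" by (simp add: vadd_ac)
          then have "t \<in> vadd s0 ` H" by (metis image_eqI vadd_self_left)
          with t(2) show ?thesis unfolding X_def by (metis imageI)
        qed
        \<comment> \<open>The bound from \<open>B - {zero}\<close> is strict in terms of
          \<open>card B\<close>: \<open>2 ^ (m - 1) < card B * 4\<close>. Both sides are powers of
          two, so a factor of two is gained.\<close>
        moreover have "2 ^ (m - 1) \<le> 2 * card B"
        proof -
          obtain e where e: "m = Suc (Suc e)" using m by (cases m; cases "m - 1") auto
          have "card B > 0" using d by simp
          with cnt2[OF False du] have "2 ^ (m - 1) < card B * 4" by linarith
          then have "(2::nat) ^ Suc e < 2 ^ (d + 2)" by (simp add: d e power_add)
          then have "Suc e < d + 2" by (rule power_less_imp_less_exp[rotated]) simp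
          then have "(2::nat) ^ Suc e \<le> 2 ^ Suc d" by (intro power_increasing) auto
          then show ?thesis by (simp add: d e)
        qed
        ultimately show ?thesis using X m0 B by (intro coset_of_hyperplane[of m B])
      qed
      then obtain C where "subspace m C" "card C = 2 ^ (m - 1)" "X = vadd (f s0) ` C" by auto
      then show False
        using dhat_not_hyperplane[OF f(1) n H(1) s0 _ a(2) _ _ m0] True X_def by auto
    qed
  qed
qed

section \<open>Blocks, walls and parallel maps\<close>

definition emb :: "nat \<Rightarrow> nat \<Rightarrow> vec \<Rightarrow> vec" where
  "emb m j s = (\<lambda>i. i div m = j \<and> s (i mod m))"

lemma emb_vadd: "emb m j (vadd s t) = vadd (emb m j s) (emb m j t)"
  by (auto simp: emb_def vadd_def fun_eq_iff)

lemma emb_zero [simp]: "emb m j zero = zero"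
  by (auto simp: emb_def zero_def fun_eq_iff)

lemma emb_in_Vsp [simp]:
  assumes "j < b" "s \<in> Vsp m"
  shows "emb m j s \<in> Vsp (m * b)"
proof -
  have "\<not> emb m j s i" if i: "m * b \<le> i" for i
  proof (cases "m = 0")
    case True
    with assms show ?thesis by (simp add: emb_def Vsp_def)
  next
    case False
    then have "b \<le> i div m" using i by (simp add: less_eq_div_iff_mult_less_eq mult.commute)
    with assms show ?thesis by (simp add: emb_def)
  qed
  then show ?thesis by (simp add: Vsp_def)
qed

lemma comp_vadd: "comp m j (vadd x y) = vadd (comp m j x) (comp m j y)"
  by (auto simp: comp_def vadd_def fun_eq_iff)

lemma comp_in_Vsp [simp]: "comp m j x \<in> Vsp m"
  by (auto simp: comp_def Vsp_def)

lemma comp_emb: "s \<in> Vsp m \<Longrightarrow> comp m j (emb m k s) = (if j = k then s else zero)"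
  by (auto simp: comp_def emb_def zero_def Vsp_def fun_eq_iff)

lemma vec_eqI:
  assumes "x \<in> Vsp (m * b)" "y \<in> Vsp (m * b)" "\<And>k. k < b \<Longrightarrow> comp m k x = comp m k y"
  shows "x = y"
proof
  fix i
  show "x i = y i"
  proof (cases "i < m * b")
    case True
    then have "m > 0" "i div m < b" by (auto simp: less_mult_imp_div_less mult.commute intro: gr0I)
    with assms(3)[of "i div m"] have "comp m (i div m) x (i mod m) = comp m (i div m) y (i mod m)"
      by simp
    then show ?thesis using \<open>m > 0\<close> by (simp add: comp_def)
  next
    case False
    then show ?thesis using assms by (simp add: Vsp_def)
  qed
qed

lemma blk_eq: "j < b \<Longrightarrow> blk m b j = emb m j ` Vsp m"
proof (intro equalityI subsetI)
  fix v assume j: "j < b" and v: "v \<in> blk m b j"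
  have "v = emb m j (comp m j v)"
  proof
    fix i
    have "v i \<Longrightarrow> m > 0" using v by (auto simp: blk_def Vsp_def intro!: gr0I)
    moreover have "v i \<Longrightarrow> i div m = j" using v by (auto simp: blk_def)
    moreover have "i div m = j \<Longrightarrow> j * m + i mod m = i" using div_mult_mod_eq[of i m] by simp
    moreover have "m = 0 \<Longrightarrow> \<not> emb m j (comp m j v) i" by (simp add: emb_def comp_def)
    ultimately show "v i = emb m j (comp m j v) i" by (auto simp: emb_def comp_def)
  qed
  then show "v \<in> emb m j ` Vsp m" by (metis comp_in_Vsp imageI)
qed (auto simp: blk_def, simp add: emb_def)

lemma wall_iff:
  assumes m: "m > 0"
  shows "v \<in> wall m b I \<longleftrightarrow> v \<in> Vsp (m * b) \<and> (\<forall>k<b. k \<notin> I \<longrightarrow> comp m k v = zero)"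
proof (intro iffI conjI allI impI)
  assume v: "v \<in> wall m b I"
  then show "v \<in> Vsp (m * b)" by (simp add: wall_def)
  fix k assume "k < b" "k \<notin> I"
  with v show "comp m k v = zero" by (auto simp: wall_def comp_def zero_def fun_eq_iff)
next
  assume v: "v \<in> Vsp (m * b) \<and> (\<forall>k<b. k \<notin> I \<longrightarrow> comp m k v = zero)"
  have "i div m \<in> I" if "v i" for i
  proof (rule ccontr)
    assume n: "i div m \<notin> I"
    have "i < m * b" using v that by (force simp: Vsp_def not_less[symmetric])
    then have "i div m < b" by (simp add: less_mult_imp_div_less mult.commute)
    with v n have "comp m (i div m) v (i mod m) = zero (i mod m)" by simp
    with that m show False by (simp add: comp_def zero_def)
  qed
  with v show "v \<in> wall m b I" by (simp add: wall_def)
qed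

lemma blk_eq_wall: "blk m b j = wall m b {j}"
  by (simp add: blk_def wall_def)

text \<open>A vector is the sum of its block components. \<open>tr k\<close> keeps the first
  \<open>k\<close> blocks of \<open>w\<close>, and blocks outside \<open>I\<close> add
  nothing.\<close>

lemma wall_induct:
  assumes m: "m > 0" and w: "w \<in> wall m b I" and z: "P zero"
    and st: "\<And>v k s. v \<in> Vsp (m * b) \<Longrightarrow> k < b \<Longrightarrow> k \<in> I \<Longrightarrow> s \<in> Vsp m \<Longrightarrow> P v \<Longrightarrow> P (vadd v (emb m k s))"
  shows "P w"
proof -
  define tr where "tr k = (\<lambda>i. w i \<and> i div m < k)" for k
  have wV: "w \<in> Vsp (m * b)" using w by (simp add: wall_def)
  then have trV: "tr k \<in> Vsp (m * b)" for k by (auto simp: tr_def Vsp_def)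
  have "P (tr k)" if "k \<le> b" for k
    using that
  proof (induction k)
    case 0
    have "tr 0 = zero" by (auto simp: tr_def zero_def)
    with z show ?case by simp
  next
    case (Suc k)
    have eq: "tr (Suc k) = vadd (tr k) (emb m k (comp m k w))"
    proof
      fix i
      show "tr (Suc k) i = vadd (tr k) (emb m k (comp m k w)) i"
        using div_mult_mod_eq[of i m] m
        by (auto simp: tr_def vadd_def emb_def comp_def less_Suc_eq)
    qed
    show ?case
    proof (cases "k \<in> I")
      case True
      with Suc st trV eq show ?thesis by simp
    next
      case False
      then have "comp m k w = zero" using w Suc.prems by (simp add: wall_iff[OF m])
      with Suc eq show ?thesis by simp
    qed
  qed
  moreover have "tr b = w"
    using wV by (auto simp: tr_def Vsp_def fun_eq_iff)
      (metis less_mult_imp_div_less mult.commute not_le)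
  ultimately show ?thesis by auto
qed

lemma Vsp_eq_wall: "m > 0 \<Longrightarrow> Vsp (m * b) = wall m b {0..<b}"
  by (auto simp: wall_iff)

section \<open>Parallel maps act block by block\<close>

lemma par_in_Vsp [simp]: "par m b f x \<in> Vsp (m * b)"
  by (simp add: par_def Vsp_def)

lemma comp_par:
  assumes "k < b" "f k (comp m k x) \<in> Vsp m"
  shows "comp m k (par m b f x) = f k (comp m k x)"
proof
  fix i
  have "k * m + i < m * b" if "i < m"
  proof -
    have "k * m + i < Suc k * m" using that by simp
    also have "\<dots> \<le> b * m" using assms(1) by (intro mult_le_mono1) simp
    finally show ?thesis by (simp add: mult.commute)
  qed
  then show "comp m k (par m b f x) i = f k (comp m k x) i"
    using assms(2) by (auto simp: comp_def par_def Vsp_def)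
qed

lemma par_inv:
  assumes f: "\<And>j. j < b \<Longrightarrow> bij_betw (f j) (Vsp m) (Vsp m)" and x: "x \<in> Vsp (m * b)"
  shows "par m b (\<lambda>j. inv_into (Vsp m) (f j)) (par m b f x) = x"
    and "par m b f (par m b (\<lambda>j. inv_into (Vsp m) (f j)) x) = x"
proof -
  note V = bij_betw_apply[OF f] bij_betw_apply[OF bij_betw_inv_into[OF f]]
  show "par m b (\<lambda>j. inv_into (Vsp m) (f j)) (par m b f x) = x"
    using V by (intro vec_eqI[OF par_in_Vsp x]) (simp add: comp_par bij_betw_inv_into_left[OF f])
  show "par m b f (par m b (\<lambda>j. inv_into (Vsp m) (f j)) x) = x"
    using V by (intro vec_eqI[OF par_in_Vsp x]) (simp add: comp_par bij_betw_inv_into_right[OF f])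
qed

lemma bij_par:
  assumes f: "\<And>j. j < b \<Longrightarrow> bij_betw (f j) (Vsp m) (Vsp m)"
  shows "bij_betw (par m b f) (Vsp (m * b)) (Vsp (m * b))"
  by (rule bij_betw_byWitness[where f' = "par m b (\<lambda>j. inv_into (Vsp m) (f j))"])
     (auto simp: par_inv f)

text \<open>S-boxes act independently, so a change within one block is answered in that block alone.
  Through this identity the derivatives of S-boxes enter.\<close>

lemma par_vadd_emb:
  assumes f: "\<And>j. j < b \<Longrightarrow> bij_betw (f j) (Vsp m) (Vsp m)"
    and x: "x \<in> Vsp (m * b)" and j: "j < b" and s: "s \<in> Vsp m"
  shows "par m b f (vadd x (emb m j s)) =
    vadd (par m b f x) (emb m j (dhat (f j) s (comp m j x)))"
proof -
  note fV = bij_betw_apply[OF f]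
  have dV: "dhat (f j) s (comp m j x) \<in> Vsp m" using j s fV by (simp add: dhat_def)
  show ?thesis
  proof (rule vec_eqI[of _ m b])
    fix k assume k: "k < b"
    with dV show "comp m k (par m b f (vadd x (emb m j s))) =
      comp m k (vadd (par m b f x) (emb m j (dhat (f j) s (comp m j x))))"
      using k s fV by (auto simp: comp_par comp_vadd comp_emb dhat_def vadd_ac)
  qed (use j dV in auto)
qed

section \<open>Relations preserved by at least half of the translations\<close>

definition stab :: "nat \<Rightarrow> (vec \<Rightarrow> vec \<Rightarrow> bool) \<Rightarrow> vec set" where
  "stab n R = {u \<in> Vsp n. \<forall>s\<in>Vsp n. \<forall>t\<in>Vsp n. R s t \<longrightarrow> R (vadd s u) (vadd t u)}"

text \<open>An equivalence relation whose full translation stabilizer has index at most two, phrased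
  as in \<open>index2_iff\<close>. All clauses are relative to \<open>Vsp n\<close>, since the
  relations arise by pulling back along maps of that set.\<close>

definition half_invariant :: "nat \<Rightarrow> (vec \<Rightarrow> vec \<Rightarrow> bool) \<Rightarrow> bool" where
  "half_invariant n R \<longleftrightarrow>
     (\<forall>s\<in>Vsp n. R s s) \<and>
     (\<forall>s\<in>Vsp n. \<forall>t\<in>Vsp n. R s t \<longrightarrow> R t s) \<and>
     (\<forall>s\<in>Vsp n. \<forall>t\<in>Vsp n. \<forall>u\<in>Vsp n. R s t \<longrightarrow> R t u \<longrightarrow> R s u) \<and>
     (\<forall>u\<in>Vsp n - stab n R. \<forall>v\<in>Vsp n - stab n R. vadd u v \<in> stab n R)"

locale half_inv =
  fixes n R
  assumes hi: "half_invariant n R"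
begin

abbreviation "U \<equiv> stab n R"

lemma R_refl: "s \<in> Vsp n \<Longrightarrow> R s s"
  and R_sym: "s \<in> Vsp n \<Longrightarrow> t \<in> Vsp n \<Longrightarrow> R s t \<Longrightarrow> R t s"
  and R_trans: "s \<in> Vsp n \<Longrightarrow> t \<in> Vsp n \<Longrightarrow> u \<in> Vsp n \<Longrightarrow> R s t \<Longrightarrow> R t u \<Longrightarrow> R s u"
  and index2: "u \<in> Vsp n \<Longrightarrow> v \<in> Vsp n \<Longrightarrow> u \<notin> U \<Longrightarrow> v \<notin> U \<Longrightarrow> vadd u v \<in> U"
  using hi unfolding half_invariant_def by blast+

lemma U_Vsp: "u \<in> U \<Longrightarrow> u \<in> Vsp n"
  by (simp add: stab_def)

lemma R_shift: "u \<in> U \<Longrightarrow> s \<in> Vsp n \<Longrightarrow> t \<in> Vsp n \<Longrightarrow> R s t \<Longrightarrow> R (vadd s u) (vadd t u)"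
  by (simp add: stab_def)

lemma subspace_U: "subspace n U"
  unfolding subspace_def
proof (intro conjI ballI)
  fix x y assume xy: "x \<in> U" "y \<in> U"
  have "R (vadd s (vadd x y)) (vadd t (vadd x y))" if "s \<in> Vsp n" "t \<in> Vsp n" "R s t" for s t
    using R_shift[OF xy(2) _ _ R_shift[OF xy(1) that]] that xy U_Vsp by (simp add: vadd.assoc)
  moreover have "vadd x y \<in> Vsp n" using xy U_Vsp by simp
  ultimately show "vadd x y \<in> U" unfolding stab_def by blast
qed (auto simp: stab_def)

lemma U_vadd: "x \<in> U \<Longrightarrow> y \<in> U \<Longrightarrow> vadd x y \<in> U"
  using subspaceD(3)[OF subspace_U] .

text \<open>If \<open>w = x + y\<close> were not in \<open>U\<close>, then \<open>V\<close> would be the union of \<open>x + U\<close> and \<open>y + U\<close>, and translating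
  \<open>R x y\<close> by \<open>U\<close> would show that \<open>w\<close> preserves \<open>R\<close>.\<close>

lemma R_imp_U:
  assumes x: "x \<in> Vsp n" and y: "y \<in> Vsp n" and R: "R x y"
  shows "vadd x y \<in> U"
proof (rule ccontr)
  define w where "w = vadd x y"
  assume "vadd x y \<notin> U"
  then have w: "w \<in> Vsp n" "w \<notin> U" using x y by (auto simp: w_def)
  have yw: "y = vadd x w" by (simp add: w_def)
  have "R z (vadd z w)" if z: "z \<in> Vsp n" for z
  proof (cases "vadd x z \<in> U")
    case True
    from R_shift[OF True x y R] show ?thesis by (simp add: yw vadd_ac)
  next
    case False
    with index2[of "vadd x z" w] w x z have "vadd (vadd x z) w \<in> U" by simp
    from R_shift[OF this x y R] have "R (vadd z w) z" by (simp add: yw vadd_ac)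
    then show ?thesis using R_sym z w by simp
  qed note * = this
  have "R (vadd s w) (vadd t w)" if st: "s \<in> Vsp n" "t \<in> Vsp n" "R s t" for s t
  proof -
    have V: "vadd s w \<in> Vsp n" "vadd t w \<in> Vsp n" using st w by auto
    have "R (vadd s w) t"
      by (rule R_trans[OF V(1) st(1,2) R_sym[OF st(1) V(1) *[OF st(1)]] st(3)])
    then show ?thesis by (rule R_trans[OF V(1) st(2) V(2) _ *[OF st(2)]])
  qed
  then have "w \<in> U" using w(1) unfolding stab_def by blast
  with w show False by simp
qed

end

section \<open>Parallel maps between half-invariant relations\<close>

text \<open>\<open>R\<close> describes a partition before the S-box layer and \<open>R'\<close> its
  image after it. In the application \<open>R'\<close> is the next relation, pulled back through the
  linear layer.\<close>

locale parallel_pair =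
  fixes m b :: nat and f :: "nat \<Rightarrow> vec \<Rightarrow> vec" and R R' :: "vec \<Rightarrow> vec \<Rightarrow> bool"
  assumes m: "m > 1"
    and f_bij: "\<And>j. j < b \<Longrightarrow> bij_betw (f j) (Vsp m) (Vsp m)"
    and f_zero: "\<And>j. j < b \<Longrightarrow> f j zero = zero"
    and hiR: "half_invariant (m * b) R" and hiR': "half_invariant (m * b) R'"
    and par_R: "\<And>s t. s \<in> Vsp (m * b) \<Longrightarrow> t \<in> Vsp (m * b) \<Longrightarrow>
      R s t \<longleftrightarrow> R' (par m b f s) (par m b f t)"
begin

sublocale P: half_inv "m * b" R by unfold_locales (rule hiR)
sublocale Q: half_inv "m * b" R' by unfold_locales (rule hiR')

abbreviation "V \<equiv> Vsp (m * b)"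
abbreviation "\<gamma> \<equiv> par m b f"

text \<open>With \<open>V_j\<close> inside \<open>Q.U\<close>, the relation \<open>R'\<close> on the
  coset of \<open>V_j\<close> through \<open>\<gamma> p\<close> is congruence modulo a subspace
  \<open>B\<close> of the block. The pair \<open>x\<close>, \<open>y\<close> supplies the derivative
  that \<open>sbox_full\<close> needs to make \<open>B\<close> everything.\<close>

lemma block_full:
  assumes j: "j < b" and sb: "anti_inv_sbox m (f j) \<or> spanning_sbox m (f j)"
    and sub: "blk m b j \<subseteq> Q.U"
    and x: "x \<in> V" and y: "y \<in> V" and Rxy: "R x y" and ne: "comp m j x \<noteq> comp m j y"
  shows "blk m b j \<subseteq> P.U" "\<forall>v\<in>blk m b j. R x (vadd x v)"
proof -
  let ?f = "f j"
  let ?e = "emb m j"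
  note fV = bij_betw_apply[OF f_bij[OF j]]
  note eV = emb_in_Vsp[OF j]
  have subU: "?e s \<in> Q.U" if "s \<in> Vsp m" for s using sub that by (auto simp: blk_eq[OF j])
  \<comment> \<open>\<open>p\<close> and \<open>q\<close> are \<open>x\<close> and \<open>y\<close>
    with component \<open>j\<close> cleared. As \<open>f j\<close> fixes \<open>zero\<close>, the
    layer acts on their cosets of \<open>V_j\<close> as \<open>f j\<close> acts on
    \<open>Vsp m\<close>.\<close>
  define p where "p = vadd x (?e (comp m j x))"
  define q where "q = vadd y (?e (comp m j y))"
  define H where "H = {s \<in> Vsp m. ?e s \<in> P.U}"
  define B where "B = {v \<in> Vsp m. R' (\<gamma> p) (vadd (\<gamma> p) (?e v))}"
  define s0 where "s0 = comp m j x"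
  define a where "a = vadd (comp m j x) (comp m j y)"
  have s0: "s0 \<in> Vsp m" and a: "a \<in> Vsp m" "a \<noteq> zero" using ne by (auto simp: s0_def a_def)
  have pq: "p \<in> V" "q \<in> V" using x y eV by (auto simp: p_def q_def)
  have g: "\<gamma> (vadd z (?e s)) = vadd (\<gamma> z) (?e (?f s))" if "z \<in> {p, q}" "s \<in> Vsp m" for z s
  proof -
    have "comp m j z = zero" using that by (auto simp: p_def q_def comp_vadd comp_emb)
    then show ?thesis using par_vadd_emb[OF f_bij, where x = z and j = j and s = s] that pq j
      by (auto simp: dhat_def f_zero)
  qed
  have gV: "\<gamma> z \<in> V" for z by simp
  have R_iff: "R (vadd z (?e s)) (vadd z' (?e t)) \<longleftrightarrow>
      R' (vadd (\<gamma> z) (?e (?f s))) (vadd (\<gamma> z') (?e (?f t)))"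
    if "z \<in> {p, q}" "z' \<in> {p, q}" "s \<in> Vsp m" "t \<in> Vsp m" for z z' s t
    using par_R[of "vadd z (?e s)" "vadd z' (?e t)"] that g pq eV by auto
  have S: "vadd (?f s) (?f t) \<in> B \<longleftrightarrow> R (vadd p (?e s)) (vadd p (?e t))"
    if st: "s \<in> Vsp m" "t \<in> Vsp m" for s t
  proof
    assume "vadd (?f s) (?f t) \<in> B"
    then have "R' (\<gamma> p) (vadd (\<gamma> p) (?e (vadd (?f s) (?f t))))" by (simp add: B_def)
    from Q.R_shift[OF subU[OF fV[OF st(1)]] _ _ this]
    have "R' (vadd (\<gamma> p) (?e (?f s))) (vadd (\<gamma> p) (?e (?f t)))"
      using st fV eV by (simp add: emb_vadd vadd_ac)
    then show "R (vadd p (?e s)) (vadd p (?e t))" using R_iff st by simp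
  next
    assume "R (vadd p (?e s)) (vadd p (?e t))"
    then have "R' (vadd (\<gamma> p) (?e (?f s))) (vadd (\<gamma> p) (?e (?f t)))" using R_iff st by simp
    from Q.R_shift[OF subU[OF fV[OF st(1)]] _ _ this]
    show "vadd (?f s) (?f t) \<in> B"
      using st fV eV by (simp add: B_def emb_vadd vadd_ac)
  qed
  have H: "subspace m H"
    using P.U_vadd P.subspace_U by (auto simp: subspace_def H_def emb_vadd)
  have "\<forall>u\<in>Vsp m - H. \<forall>v\<in>Vsp m - H. vadd u v \<in> H"
    using P.index2 eV by (auto simp: H_def emb_vadd)
  with index2_iff[OF H] m have Hc: "2 ^ (m - 1) \<le> card H" by simp
  have B: "subspace m B"
    unfolding subspace_def
  proof (intro conjI ballI)
    show "zero \<in> B" using Q.R_refl by (simp add: B_def)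
    fix v w assume vw: "v \<in> B" "w \<in> B"
    then have V: "v \<in> Vsp m" "w \<in> Vsp m" by (auto simp: B_def)
    from vw have v: "R' (\<gamma> p) (vadd (\<gamma> p) (?e v))" and w: "R' (\<gamma> p) (vadd (\<gamma> p) (?e w))"
      by (auto simp: B_def)
    have "R' (vadd (\<gamma> p) (?e w)) (vadd (\<gamma> p) (?e (vadd v w)))"
      using Q.R_shift[OF subU[OF V(2)] _ _ v] V eV by (simp add: emb_vadd vadd_ac)
    from Q.R_trans[OF _ _ _ w this] show "vadd v w \<in> B" using V eV by (simp add: B_def)
  qed (auto simp: B_def)
  have "B = Vsp m"
  proof (rule sbox_full[OF f_bij[OF j] f_zero[OF j] m sb H Hc B _ _ a s0])
    fix s t assume st: "s \<in> Vsp m" "t \<in> Vsp m" "vadd (?f s) (?f t) \<in> B"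
    then have R: "R (vadd p (?e s)) (vadd p (?e t))" by (simp add: S)
    have V: "vadd p (?e s) \<in> V" "vadd p (?e t) \<in> V" using st pq eV by auto
    from P.R_imp_U[OF V R] have "?e (vadd s t) \<in> P.U" by (simp add: emb_vadd vadd_ac)
    then show "vadd s t \<in> H" using st by (simp add: H_def)
    fix h assume "h \<in> H"
    then have h: "h \<in> Vsp m" "?e h \<in> P.U" by (auto simp: H_def)
    from P.R_shift[OF h(2) V R] have "R (vadd p (?e (vadd s h))) (vadd p (?e (vadd t h)))"
      by (simp add: emb_vadd vadd_ac)
    then show "vadd (?f (vadd s h)) (?f (vadd t h)) \<in> B" using S st h by simp
  next
    fix h assume "h \<in> H"
    then have h: "h \<in> Vsp m" "?e h \<in> P.U" by (auto simp: H_def)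
    let ?d = "\<lambda>s. dhat ?f a s"
    have dV: "?d s \<in> Vsp m" if "s \<in> Vsp m" for s using that a fV by (simp add: dhat_def)
    \<comment> \<open>Translate the pair \<open>x\<close>, \<open>y\<close> by \<open>h\<close>,
      apply the layer, and translate the first point back to \<open>\<gamma> p\<close>. The second
      point then carries the value of the derivative at \<open>vadd s0 h\<close>.\<close>
    have K: "R' (\<gamma> p) (vadd (\<gamma> q) (?e (?d (vadd s0 h))))"
      if h: "h \<in> Vsp m" "?e h \<in> P.U" for h
    proof -
      let ?s = "vadd s0 h"
      have s: "?s \<in> Vsp m" "vadd ?s a \<in> Vsp m" using s0 h a by auto
      have "R (vadd p (?e ?s)) (vadd q (?e (vadd ?s a)))"
        using P.R_shift[OF h(2) x y Rxy] by (simp add: p_def q_def s0_def a_def emb_vadd vadd_ac)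
      then have "R' (vadd (\<gamma> p) (?e (?f ?s))) (vadd (\<gamma> q) (?e (?f (vadd ?s a))))"
        using R_iff s by simp
      from Q.R_shift[OF subU[OF fV[OF s(1)]] _ _ this] show ?thesis
        using s fV eV by (simp add: dhat_def emb_vadd vadd_ac)
    qed
    note K0 = K[OF zero_in_Vsp, unfolded vadd.right_neutral emb_zero, OF subspaceD(2)[OF P.subspace_U]]
    let ?d0 = "?d s0" and ?d1 = "?d (vadd s0 h)"
    have V: "vadd (\<gamma> q) (?e ?d0) \<in> V" "vadd (\<gamma> q) (?e ?d1) \<in> V" using dV s0 h eV by auto
    have "R' (vadd (\<gamma> q) (?e ?d0)) (vadd (\<gamma> q) (?e ?d1))"
      by (rule Q.R_trans[OF V(1) gV V(2) Q.R_sym[OF gV V(1) K0] K[OF h]])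
    \<comment> \<open>The difference of a related pair is itself an admissible translation. It
      carries the comparison of two derivative values from the coset of \<open>\<gamma> q\<close> to
      that of \<open>\<gamma> p\<close>, where \<open>B\<close> is defined.\<close>
    moreover have "vadd (\<gamma> p) (vadd (\<gamma> q) (?e ?d0)) \<in> Q.U"
      by (rule Q.R_imp_U[OF gV V(1) K0])
    ultimately have "R' (vadd (vadd (\<gamma> q) (?e ?d0)) (vadd (\<gamma> p) (vadd (\<gamma> q) (?e ?d0))))
      (vadd (vadd (\<gamma> q) (?e ?d1)) (vadd (\<gamma> p) (vadd (\<gamma> q) (?e ?d0))))"
      using Q.R_shift V by blast
    then have "R' (\<gamma> p) (vadd (\<gamma> p) (?e (vadd ?d1 ?d0)))"
      by (simp add: emb_vadd vadd_ac)
    then show "vadd ?d1 ?d0 \<in> B" using dV s0 h by (simp add: B_def)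
  qed
  then have all: "R (vadd p (?e s)) (vadd p (?e t))" if "s \<in> Vsp m" "t \<in> Vsp m" for s t
    using S[OF that] that fV by simp
  show "blk m b j \<subseteq> P.U"
  proof -
    have "?e s \<in> P.U" if s: "s \<in> Vsp m" for s
      using P.R_imp_U[OF _ _ all[OF s zero_in_Vsp]] s pq eV by (simp add: vadd_ac)
    then show ?thesis by (auto simp: blk_eq[OF j])
  qed
  show "\<forall>v\<in>blk m b j. R x (vadd x v)"
  proof -
    have "R x (vadd x (?e s))" if s: "s \<in> Vsp m" for s
      using all[of s0 "vadd s0 s"] s0 s by (simp add: p_def s0_def emb_vadd vadd_ac)
    then show ?thesis by (auto simp: blk_eq[OF j])
  qed
qed

text \<open>The setting is symmetric under inversion of the layer, so \<open>block_full\<close> can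
  be used with the two sides exchanged.\<close>

lemma inv_pair: "parallel_pair m b (\<lambda>j. inv_into (Vsp m) (f j)) R' R"
proof
  fix j assume j: "j < b"
  show "bij_betw (inv_into (Vsp m) (f j)) (Vsp m) (Vsp m)" by (rule bij_betw_inv_into[OF f_bij[OF j]])
  show "inv_into (Vsp m) (f j) zero = zero"
    using bij_betw_inv_into_left[OF f_bij[OF j], of zero] by (simp add: f_zero[OF j])
next
  fix s t assume "s \<in> V" "t \<in> V"
  then show "R' s t \<longleftrightarrow> R (par m b (\<lambda>j. inv_into (Vsp m) (f j)) s) (par m b (\<lambda>j. inv_into (Vsp m) (f j)) t)"
    by (simp add: par_R par_inv f_bij)
qed (use m hiR hiR' in auto)

lemma par_wall:
  assumes x: "x \<in> V" and y: "y \<in> V"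
  shows "vadd x y \<in> wall m b I \<longleftrightarrow> vadd (\<gamma> x) (\<gamma> y) \<in> wall m b I"
proof -
  have "comp m k (\<gamma> x) = comp m k (\<gamma> y) \<longleftrightarrow> comp m k x = comp m k y" if "k < b" for k
    using bij_betw_apply[OF f_bij[OF that]] bij_betw_imp_inj_on[OF f_bij[OF that]] that
    by (simp add: comp_par inj_on_eq_iff)
  then show ?thesis using x y m by (auto simp: wall_iff comp_vadd)
qed

lemmas par_blk = par_wall[of _ _ "{j}" for j, folded blk_eq_wall]

text \<open>Fullness along \<open>V_j\<close> concerns only the coset of \<open>V_j\<close> through
  \<open>x\<close>, which the layer maps onto the coset through \<open>\<gamma> x\<close>.\<close>

lemma block_full_iff:
  assumes j: "j < b" and x: "x \<in> V"
  shows "(\<forall>v\<in>blk m b j. R x (vadd x v)) \<longleftrightarrow> (\<forall>v\<in>blk m b j. R' (\<gamma> x) (vadd (\<gamma> x) v))"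
proof -
  have bV: "v \<in> V" if "v \<in> blk m b j" for v using that by (simp add: blk_def)
  have 1: "(\<forall>v\<in>blk m b j. R x (vadd x v)) \<longleftrightarrow> (\<forall>y\<in>V. vadd x y \<in> blk m b j \<longrightarrow> R x y)"
    using x bV by (metis vadd_in_Vsp vadd_self_left)
  have 2: "(\<forall>v\<in>blk m b j. R' (\<gamma> x) (vadd (\<gamma> x) v)) \<longleftrightarrow>
      (\<forall>z\<in>V. vadd (\<gamma> x) z \<in> blk m b j \<longrightarrow> R' (\<gamma> x) z)"
    using bV par_in_Vsp by (metis vadd_in_Vsp vadd_self_left)
  have 3: "V = \<gamma> ` V" using bij_par[OF f_bij] by (simp add: bij_betw_def)
  show ?thesis
    unfolding 1 2 using par_blk[OF x] par_R[OF x] by (subst (2) 3) simp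
qed

end

text \<open>The assumption \<open>cover\<close> is the form taken by the disjointness of the two
  sets \<open>Jset\<close>.\<close>

locale sbox_pair = parallel_pair +
  assumes sb: "(\<forall>j<b. anti_inv_sbox m (f j)) \<or> (\<forall>j<b. spanning_sbox m (f j))"
    and cover: "\<And>j. j < b \<Longrightarrow> blk m b j \<subseteq> P.U \<or> blk m b j \<subseteq> Q.U"
begin

text \<open>\<open>block_full\<close> gives everything once \<open>V_j\<close> lies in
  \<open>Q.U\<close>, so the case to settle is \<open>V_j\<close> inside \<open>P.U\<close>.
  Anti-invariance passes to the inverse layer, where \<open>block_full\<close> applies; for spanning
  S-boxes the derivative is examined directly.\<close>

lemma related_block:
  assumes j: "j < b" and x: "x \<in> V" and y: "y \<in> V" and Rxy: "R x y"
    and ne: "comp m j x \<noteq> comp m j y"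
  shows "blk m b j \<subseteq> P.U" "blk m b j \<subseteq> Q.U" "\<forall>v\<in>blk m b j. R x (vadd x v)"
proof -
  note fV = bij_betw_apply[OF f_bij[OF j]]
  have "blk m b j \<subseteq> Q.U" if P: "blk m b j \<subseteq> P.U"
    using sb
  proof
    assume w: "\<forall>j<b. anti_inv_sbox m (f j)"
    interpret I: parallel_pair m b "\<lambda>j. inv_into (Vsp m) (f j)" R' R by (rule inv_pair)
    have "f j (comp m j x) \<noteq> f j (comp m j y)"
      using ne bij_betw_imp_inj_on[OF f_bij[OF j]] by (simp add: inj_on_eq_iff)
    then show ?thesis
      using I.block_full(1)[OF j _ P, of "\<gamma> x" "\<gamma> y"] anti_inv_sbox_inv[OF f_bij[OF j]] w j x y Rxy fV
      by (simp add: comp_par par_R)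
  next
    assume n: "\<forall>j<b. spanning_sbox m (f j)"
    \<comment> \<open>\<open>H\<close> is the trace of \<open>Q.U\<close> on block \<open>j\<close>.
      Translations by \<open>V_j\<close> keep \<open>x\<close> and \<open>y\<close> related, and
      differences of related images lie in \<open>Q.U\<close>, so the derivative in direction
      \<open>a\<close> stays in one coset of \<open>H\<close>.\<close>
    define H where "H = {s \<in> Vsp m. emb m j s \<in> Q.U}"
    define a where "a = vadd (comp m j x) (comp m j y)"
    define D where "D = vadd (\<gamma> x) (\<gamma> y)"
    have a: "a \<in> Vsp m" "a \<noteq> zero" using ne by (auto simp: a_def)
    have H: "subspace m H"
      using Q.U_vadd Q.subspace_U by (auto simp: subspace_def H_def emb_vadd)
    have D: "D \<in> Q.U"
      unfolding D_def by (rule Q.R_imp_U) (use x y Rxy par_R in auto)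
    have "vadd (dhat (f j) a s) (dhat (f j) a (comp m j x)) \<in> H" if s: "s \<in> Vsp m" for s
    proof -
      define v where "v = vadd s (comp m j x)"
      have v: "v \<in> Vsp m" using s by (simp add: v_def)
      then have vU: "emb m j v \<in> P.U" using P by (auto simp: blk_eq[OF j])
      note V = emb_in_Vsp[OF j v]
      have "R (vadd x (emb m j v)) (vadd y (emb m j v))" by (rule P.R_shift[OF vU x y Rxy])
      then have "R' (\<gamma> (vadd x (emb m j v))) (\<gamma> (vadd y (emb m j v)))"
        using par_R x y V by simp
      from Q.R_imp_U[OF par_in_Vsp par_in_Vsp this]
      have "vadd D (emb m j (vadd (dhat (f j) v (comp m j x)) (dhat (f j) v (comp m j y)))) \<in> Q.U"
        by (simp add: par_vadd_emb[OF f_bij] x y j v D_def emb_vadd vadd_ac)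
      from Q.U_vadd[OF D this]
      have "emb m j (vadd (dhat (f j) v (comp m j x)) (dhat (f j) v (comp m j y))) \<in> Q.U" by simp
      \<comment> \<open>Second differences do not depend on the order of the two directions, here
        \<open>v\<close> and \<open>a\<close>.\<close>
      moreover have "vadd (dhat (f j) v (comp m j x)) (dhat (f j) v (comp m j y)) =
          vadd (dhat (f j) a s) (dhat (f j) a (comp m j x))"
        by (simp add: dhat_def v_def a_def vadd_ac)
      ultimately show ?thesis using s a fV by (simp add: H_def dhat_def)
    qed
    with n j a H have "H = Vsp m" unfolding spanning_sbox_def by blast
    then show ?thesis by (auto simp: blk_eq[OF j] H_def)
  qed
  with cover[OF j] show Q: "blk m b j \<subseteq> Q.U" by blast
  have "anti_inv_sbox m (f j) \<or> spanning_sbox m (f j)" using sb j by blast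
  from block_full[OF j this Q x y Rxy ne]
  show "blk m b j \<subseteq> P.U" "\<forall>v\<in>blk m b j. R x (vadd x v)" .
qed

text \<open>Otherwise \<open>x + U\<close> would be the set of points whose part contains their \<open>V_j\<close>-coset, and \<open>\<gamma>\<close>
  would map it onto a coset of \<open>U'\<close>.  A block \<open>V_k\<close> not contained in \<open>U\<close> is contained in \<open>U'\<close>, which is
  impossible as \<open>\<gamma>\<close> preserves the cosets of \<open>V_k\<close>.\<close>

lemma full_block_everywhere:
  assumes j: "j < b" and x: "x \<in> V" and y: "y \<in> V" and Rxy: "R x y"
    and ne: "comp m j x \<noteq> comp m j y" and z: "z \<in> V" and v: "v \<in> blk m b j"
  shows "R z (vadd z v)"
proof -
  let ?W = "\<lambda>z. \<forall>v\<in>blk m b j. R z (vadd z v)"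
  let ?W' = "\<lambda>z. \<forall>v\<in>blk m b j. R' z (vadd z v)"
  note rb = related_block[OF j x y Rxy ne]
  have bV: "v \<in> V" if "v \<in> blk m b j" for v using that by (simp add: blk_def)
  have shP: "?W (vadd z u)" if "?W z" "z \<in> V" "u \<in> P.U" for z u
  proof
    fix v assume v: "v \<in> blk m b j"
    then have "R (vadd z u) (vadd (vadd z v) u)" using that bV by (intro P.R_shift) auto
    then show "R (vadd z u) (vadd (vadd z u) v)" by (simp add: vadd_ac)
  qed
  have shQ: "?W' (vadd z u)" if "?W' z" "z \<in> V" "u \<in> Q.U" for z u
  proof
    fix v assume v: "v \<in> blk m b j"
    then have "R' (vadd z u) (vadd (vadd z v) u)" using that bV by (intro Q.R_shift) auto
    then show "R' (vadd z u) (vadd (vadd z u) v)" by (simp add: vadd_ac)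
  qed
  show ?thesis
  proof (rule ccontr)
    assume "\<not> ?thesis"
    with v have nW: "\<not> ?W z" by blast
    have P_iff: "vadd x t \<in> P.U \<longleftrightarrow> ?W t" if t: "t \<in> V" for t
    proof
      assume "vadd x t \<in> P.U"
      from shP[OF rb(3) x this] show "?W t" by simp
    next
      assume W: "?W t"
      have "vadd t z \<notin> P.U" using shP[OF W t, of "vadd t z"] nW by auto
      moreover have "vadd x z \<notin> P.U" using shP[OF rb(3) x, of "vadd x z"] nW by auto
      ultimately have "vadd (vadd t z) (vadd x z) \<in> P.U" using t x z by (intro P.index2) auto
      then show "vadd x t \<in> P.U" by (simp add: vadd_ac)
    qed
    have W'x: "?W' (\<gamma> x)" using block_full_iff[OF j x] rb(3) by simp
    have nW'z: "\<not> ?W' (\<gamma> z)" using block_full_iff[OF j z] nW by simp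
    have Q_iff: "vadd (\<gamma> x) (\<gamma> t) \<in> Q.U \<longleftrightarrow> ?W t" if t: "t \<in> V" for t
    proof
      assume "vadd (\<gamma> x) (\<gamma> t) \<in> Q.U"
      from shQ[OF W'x _ this] show "?W t" using block_full_iff[OF j t] by simp
    next
      assume "?W t"
      then have W: "?W' (\<gamma> t)" using block_full_iff[OF j t] by simp
      have "vadd (\<gamma> t) (\<gamma> z) \<notin> Q.U" using shQ[OF W, of "vadd (\<gamma> t) (\<gamma> z)"] nW'z by auto
      moreover have "vadd (\<gamma> x) (\<gamma> z) \<notin> Q.U" using shQ[OF W'x, of "vadd (\<gamma> x) (\<gamma> z)"] nW'z by auto
      ultimately have "vadd (vadd (\<gamma> t) (\<gamma> z)) (vadd (\<gamma> x) (\<gamma> z)) \<in> Q.U" by (intro Q.index2) auto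
      then show "vadd (\<gamma> x) (\<gamma> t) \<in> Q.U" by (simp add: vadd_ac)
    qed
    have "blk m b k \<subseteq> P.U" if k: "k < b" for k
    proof (rule ccontr)
      assume n: "\<not> blk m b k \<subseteq> P.U"
      with cover[OF k] have Q: "blk m b k \<subseteq> Q.U" by blast
      from n obtain v where v: "v \<in> blk m b k" "v \<notin> P.U" by blast
      have V: "vadd x v \<in> V" using x v by (simp add: blk_def)
      have "vadd (\<gamma> x) (\<gamma> (vadd x v)) \<in> blk m b k"
        using par_blk[OF x V] v by simp
      with Q Q_iff[OF V] P_iff[OF V] v show False by auto
    qed
    then have eU: "emb m k s \<in> P.U" if "k < b" "s \<in> Vsp m" for k s
      using that by (auto simp: blk_eq subset_eq)
    have m0: "m > 0" using m by simp
    \<comment> \<open>All blocks lie in \<open>P.U\<close>, hence so does \<open>vadd x z\<close>;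
      by \<open>P_iff\<close> the part of \<open>z\<close> is then full along \<open>V_j\<close>
      after all.\<close>
    have "vadd x z \<in> wall m b {0..<b}" using x z by (simp flip: Vsp_eq_wall[OF m0])
    then have "vadd x z \<in> P.U"
      by (rule wall_induct[OF m0])
        (use eU P.U_vadd subspaceD(2)[OF P.subspace_U] in auto)
    with P_iff[OF z] nW show False by simp
  qed
qed

text \<open>\<open>I\<close> collects the blocks along which every part is full. Related points
  differing in block \<open>k\<close> force \<open>k\<close> into \<open>I\<close> by
  \<open>full_block_everywhere\<close>; conversely a wall vector is added one block at a
  time.\<close>

theorem cosets_of_wall:
  "\<exists>I \<subseteq> {0..<b}. \<forall>s\<in>V. \<forall>t\<in>V. R s t \<longleftrightarrow> vadd s t \<in> wall m b I"
proof -
  define I where "I = {j. j < b \<and> (\<forall>z\<in>V. \<forall>v\<in>blk m b j. R z (vadd z v))}"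
  have m0: "m > 0" using m by simp
  have "R s t \<longleftrightarrow> vadd s t \<in> wall m b I" if st: "s \<in> V" "t \<in> V" for s t
  proof
    assume R: "R s t"
    have "comp m k (vadd s t) = zero" if k: "k < b" "k \<notin> I" for k
      using full_block_everywhere[OF k(1) st R] k by (auto simp: I_def comp_vadd)
    then show "vadd s t \<in> wall m b I" using st by (simp add: wall_iff[OF m0])
  next
    assume w: "vadd s t \<in> wall m b I"
    have "R s (vadd s (vadd s t))"
    proof (rule wall_induct[OF m0 w])
      show "R s (vadd s zero)" using st P.R_refl by simp
    next
      fix v k e assume v: "v \<in> V" "k < b" "k \<in> I" "e \<in> Vsp m" "R s (vadd s v)"
      then have e: "emb m k e \<in> blk m b k" "emb m k e \<in> V" by (auto simp: blk_eq)
      have "R (vadd s v) (vadd (vadd s v) (emb m k e))" using v e st by (auto simp: I_def)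
      with P.R_trans[of s "vadd s v" "vadd (vadd s v) (emb m k e)"] v st e
      show "R s (vadd s (vadd v (emb m k e)))" by (simp add: vadd.assoc)
    qed
    then show "R s t" by simp
  qed
  moreover have "I \<subseteq> {0..<b}" by (auto simp: I_def)
  ultimately show ?thesis by blast
qed

end

section \<open>Two consecutive rounds\<close>

lemma GLV_D:
  assumes "l \<in> GLV n"
  shows "bij_betw l (Vsp n) (Vsp n)"
    and "x \<in> Vsp n \<Longrightarrow> l x \<in> Vsp n"
    and "x \<in> Vsp n \<Longrightarrow> y \<in> Vsp n \<Longrightarrow> l (vadd x y) = vadd (l x) (l y)"
    and "l zero = zero"
proof -
  show b: "bij_betw l (Vsp n) (Vsp n)" using assms by (simp add: GLV_def)
  show "x \<in> Vsp n \<Longrightarrow> l x \<in> Vsp n" using bij_betw_apply[OF b] .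
  show a: "x \<in> Vsp n \<Longrightarrow> y \<in> Vsp n \<Longrightarrow> l (vadd x y) = vadd (l x) (l y)" for x y
    using assms by (simp add: GLV_def)
  show "l zero = zero" using a[of zero zero] by simp
qed

lemma stab_pullback:
  assumes l: "l \<in> GLV n"
  shows "stab n (\<lambda>s t. R (l s) (l t)) = {u \<in> Vsp n. l u \<in> stab n R}"
proof -
  note L = GLV_D[OF l]
  have eq: "l ` Vsp n = Vsp n" using L(1) by (simp add: bij_betw_def)
  have "(\<forall>s\<in>Vsp n. \<forall>t\<in>Vsp n. R (l s) (l t) \<longrightarrow> R (l (vadd s u)) (l (vadd t u))) \<longleftrightarrow>
      (\<forall>s\<in>l ` Vsp n. \<forall>t\<in>l ` Vsp n. R s t \<longrightarrow> R (vadd s (l u)) (vadd t (l u)))"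
    if "u \<in> Vsp n" for u
    using that by (simp add: L(3))
  then show ?thesis unfolding stab_def eq using L(2) by auto
qed

lemma half_invariant_pullback:
  assumes l: "l \<in> GLV n" and R: "half_invariant n R"
  shows "half_invariant n (\<lambda>s t. R (l s) (l t))"
proof -
  interpret half_inv n R by unfold_locales (rule R)
  note L = GLV_D[OF l]
  show ?thesis
    unfolding half_invariant_def stab_pullback[OF l, of R]
  proof (intro conjI ballI impI)
    fix s t u assume "s \<in> Vsp n" "t \<in> Vsp n" "u \<in> Vsp n" "R (l s) (l t)" "R (l t) (l u)"
    then show "R (l s) (l u)" using R_trans[of "l s" "l t" "l u"] L(2) by simp
  qed (use R_refl R_sym index2 L(2,3) in auto)
qed

section \<open>Non-triviality and the passage through two S-box layers\<close>

definition nontriv :: "nat \<Rightarrow> (vec \<Rightarrow> vec \<Rightarrow> bool) \<Rightarrow> bool" where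
  "nontriv n R \<longleftrightarrow> (\<exists>x\<in>Vsp n. \<exists>y\<in>Vsp n. x \<noteq> y \<and> R x y) \<and> (\<exists>x\<in>Vsp n. \<exists>y\<in>Vsp n. \<not> R x y)"

lemma nontriv_map:
  assumes F: "bij_betw F (Vsp n) (Vsp n)"
    and R: "\<And>s t. s \<in> Vsp n \<Longrightarrow> t \<in> Vsp n \<Longrightarrow> R s t \<longleftrightarrow> R' (F s) (F t)" and nt: "nontriv n R"
  shows "nontriv n R'"
proof -
  from nt obtain x y z w where V: "x \<in> Vsp n" "y \<in> Vsp n" "z \<in> Vsp n" "w \<in> Vsp n"
    and xy: "x \<noteq> y" "R x y" "\<not> R z w"
    unfolding nontriv_def by blast
  have "F x \<noteq> F y" using bij_betw_imp_inj_on[OF F] V xy by (simp add: inj_on_eq_iff)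
  moreover have "R' (F x) (F y)" "\<not> R' (F z) (F w)" using R V xy by auto
  moreover note V[THEN bij_betw_apply[OF F]]
  ultimately show ?thesis unfolding nontriv_def by blast
qed

lemma nontriv_wall:
  assumes m: "m > 0" and nt: "nontriv (m * b) R" and I: "I \<subseteq> {0..<b}"
    and R: "\<forall>s\<in>Vsp (m * b). \<forall>t\<in>Vsp (m * b). R s t \<longleftrightarrow> vadd s t \<in> wall m b I"
  shows "I \<noteq> {}" "I \<subset> {0..<b}"
proof -
  show "I \<noteq> {}"
  proof
    assume "I = {}"
    then have "v = zero" if "v \<in> wall m b I" for v
      using that by (auto simp: wall_def zero_def)
    with nt R show False unfolding nontriv_def by fastforce
  qed
  have "I \<noteq> {0..<b}"
  proof
    assume "I = {0..<b}"
    with nt R show False unfolding nontriv_def by (simp flip: Vsp_eq_wall[OF m])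
  qed
  with I show "I \<subset> {0..<b}" by blast
qed

lemma two_round_contradiction:
  assumes m: "m > 1"
    and f: "\<And>j. j < b \<Longrightarrow> bij_betw (f j) (Vsp m) (Vsp m)" "\<And>j. j < b \<Longrightarrow> f j zero = zero"
    and f': "\<And>j. j < b \<Longrightarrow> bij_betw (f' j) (Vsp m) (Vsp m)" "\<And>j. j < b \<Longrightarrow> f' j zero = zero"
    and sb: "(\<forall>j<b. anti_inv_sbox m (f j)) \<or> (\<forall>j<b. spanning_sbox m (f j))"
    and sb': "(\<forall>j<b. anti_inv_sbox m (f' j)) \<or> (\<forall>j<b. spanning_sbox m (f' j))"
    and l: "strongly_proper m b l" and l': "l' \<in> GLV (m * b)"
    and hi: "half_invariant (m * b) R1" "half_invariant (m * b) R2" "half_invariant (m * b) R3"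
    and R12: "\<And>s t. s \<in> Vsp (m * b) \<Longrightarrow> t \<in> Vsp (m * b) \<Longrightarrow>
      R1 s t \<longleftrightarrow> R2 (l (par m b f s)) (l (par m b f t))"
    and R23: "\<And>s t. s \<in> Vsp (m * b) \<Longrightarrow> t \<in> Vsp (m * b) \<Longrightarrow>
      R2 s t \<longleftrightarrow> R3 (l' (par m b f' s)) (l' (par m b f' t))"
    and cover: "\<And>j. j < b \<Longrightarrow>
      blk m b j \<subseteq> stab (m * b) R1 \<or> blk m b j \<subseteq> {v \<in> Vsp (m * b). l v \<in> stab (m * b) R2}"
    and nt: "nontriv (m * b) R1"
  shows False
proof -
  have lG: "l \<in> GLV (m * b)" using l by (simp add: strongly_proper_def)
  note L = GLV_D[OF lG]
  have m0: "m > 0" using m by simp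
  let ?V = "Vsp (m * b)"
  let ?Q2 = "\<lambda>s t. R2 (l s) (l t)" and ?Q3 = "\<lambda>s t. R3 (l' s) (l' t)"
  interpret A: sbox_pair m b f R1 ?Q2
    by unfold_locales
      (use m f R12 hi half_invariant_pullback[OF lG] sb cover stab_pullback[OF lG] in auto)
  obtain I where I: "I \<subseteq> {0..<b}" "\<forall>s\<in>?V. \<forall>t\<in>?V. R1 s t \<longleftrightarrow> vadd s t \<in> wall m b I"
    using A.cosets_of_wall by blast
  note Ip = nontriv_wall[OF m0 nt I]
  have pV: "?V = par m b f ` ?V" using bij_par[of b f m] f by (simp add: bij_betw_def)
  \<comment> \<open>The layer preserves the cosets of every wall, so the relation after it belongs
    to the same \<open>I\<close>.\<close>
  have "?Q2 (par m b f s) (par m b f t) \<longleftrightarrow> vadd (par m b f s) (par m b f t) \<in> wall m b I"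
    if "s \<in> ?V" "t \<in> ?V" for s t
    using I(2) R12[OF that] A.par_wall[OF that] that by blast
  then have "\<forall>s\<in>par m b f ` ?V. \<forall>t\<in>par m b f ` ?V. ?Q2 s t \<longleftrightarrow> vadd s t \<in> wall m b I"
    by blast
  then have Q2: "?Q2 s t \<longleftrightarrow> vadd s t \<in> wall m b I" if "s \<in> ?V" "t \<in> ?V" for s t
    using that unfolding pV[symmetric] by blast
  \<comment> \<open>Cosets of a subspace are permuted by all translations. Hence \<open>R2\<close>
    is preserved by every translation, and \<open>cover\<close> holds for the second layer.\<close>
  have "u \<in> stab (m * b) ?Q2" if u: "u \<in> ?V" for u
  proof -
    have "vadd (vadd s u) (vadd t u) = vadd s t" for s t by (simp add: vadd_ac)
    then show ?thesis using u Q2 by (simp add: stab_def)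
  qed
  then have "l u \<in> stab (m * b) R2" if "u \<in> ?V" for u using that by (simp add: stab_pullback[OF lG])
  then have "l ` ?V \<subseteq> stab (m * b) R2" by blast
  then have R2_all: "?V \<subseteq> stab (m * b) R2" using L(1) by (simp add: bij_betw_def)
  interpret B: sbox_pair m b f' R2 ?Q3
  proof unfold_locales
    show "blk m b j \<subseteq> stab (m * b) R2 \<or> blk m b j \<subseteq> stab (m * b) ?Q3" for j
      using R2_all by (auto simp: blk_def)
  qed (use m f' R23 hi half_invariant_pullback[OF l'] sb' in auto)
  obtain I' where I': "I' \<subseteq> {0..<b}" "\<forall>s\<in>?V. \<forall>t\<in>?V. R2 s t \<longleftrightarrow> vadd s t \<in> wall m b I'"
    using B.cosets_of_wall by blast
  have "bij_betw (l \<circ> par m b f) ?V ?V"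
    by (rule bij_betw_trans[OF bij_par L(1)]) (rule f)
  from nontriv_map[OF this _ nt, of R2] have "nontriv (m * b) R2" using R12 by simp
  note Ip' = nontriv_wall[OF m0 this I']
  have "l ` wall m b I \<subseteq> wall m b I'"
  proof clarify
    fix v assume v: "v \<in> wall m b I"
    then have V: "v \<in> ?V" by (simp add: wall_def)
    then have "R2 (l v) (l zero)" using v Q2[of v zero] by simp
    then show "l v \<in> wall m b I'" using I'(2) L(2)[OF V] L(4) by auto
  qed
  with l Ip Ip' show False by (simp add: strongly_proper_def)
qed

section \<open>Partitions and encryption functions\<close>

text \<open>Relations pull back along a map by mere composition, so partitions are carried through
  the rounds in this form.\<close>

definition same_part :: "vec set set \<Rightarrow> vec \<Rightarrow> vec \<Rightarrow> bool" where
  "same_part P x y \<longleftrightarrow> (\<exists>X\<in>P. x \<in> X \<and> y \<in> X)"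

lemma same_part_map:
  assumes P: "is_partition S P" and f: "bij_betw f S S" and PQ: "maps_partition f P Q"
    and x: "x \<in> S" and y: "y \<in> S"
  shows "same_part P x y \<longleftrightarrow> same_part Q (f x) (f y)"
proof -
  have "f z \<in> f ` X \<longleftrightarrow> z \<in> X" if "X \<in> P" "z \<in> S" for X z
    using inj_on_image_mem_iff[OF bij_betw_imp_inj_on[OF f] that(2)] P that(1)
    by (simp add: is_partition_def)
  with x y have "(\<exists>X\<in>P. x \<in> X \<and> y \<in> X) \<longleftrightarrow> (\<exists>X\<in>P. f x \<in> f ` X \<and> f y \<in> f ` X)" by metis
  also have "\<dots> \<longleftrightarrow> (\<exists>Y\<in>Q. f x \<in> Y \<and> f y \<in> Y)"
    using PQ unfolding maps_partition_def by blast
  finally show ?thesis by (simp add: same_part_def)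
qed

lemma same_part_equiv:
  assumes "is_partition S P"
  shows "x \<in> S \<Longrightarrow> same_part P x x"
    and "same_part P x y \<Longrightarrow> same_part P y x"
    and "same_part P x y \<Longrightarrow> same_part P y z \<Longrightarrow> same_part P x z"
proof -
  show "x \<in> S \<Longrightarrow> same_part P x x" using assms by (auto simp: is_partition_def same_part_def)
  show "same_part P x y \<Longrightarrow> same_part P y x" by (auto simp: same_part_def)
  assume "same_part P x y" "same_part P y z"
  then obtain X Y where "X \<in> P" "Y \<in> P" "x \<in> X" "y \<in> X" "y \<in> Y" "z \<in> Y" by (auto simp: same_part_def)
  moreover from this have "X = Y" using assms unfolding is_partition_def by blast
  ultimately show "same_part P x z" by (auto simp: same_part_def)
qed

lemma nontriv_same_part:
  assumes P: "is_partition (Vsp n) P" and nt: "\<not> trivial_partition (Vsp n) P"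
  shows "nontriv n (same_part P)"
  unfolding nontriv_def
proof
  let ?V = "Vsp n"
  have sub: "X \<subseteq> ?V" "X \<noteq> {}" if "X \<in> P" for X using P that by (auto simp: is_partition_def)
  have cov: "\<exists>X\<in>P. x \<in> X" if "x \<in> ?V" for x using P that unfolding is_partition_def by blast
  show "\<exists>x\<in>?V. \<exists>y\<in>?V. x \<noteq> y \<and> same_part P x y"
  proof (rule ccontr)
    assume n: "\<not> ?thesis"
    have single: "X = {x}" if "X \<in> P" "x \<in> X" for X x
      using n that sub[OF that(1)] unfolding same_part_def by blast
    have "P = (\<lambda>x. {x}) ` ?V"
    proof (intro equalityI subsetI)
      fix X assume X: "X \<in> P"
      then obtain x where "x \<in> X" using sub by blast
      with single[OF X this] sub[OF X] show "X \<in> (\<lambda>x. {x}) ` ?V" by blast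
    next
      fix X assume "X \<in> (\<lambda>x. {x}) ` ?V"
      then obtain x where "x \<in> ?V" "X = {x}" by blast
      with cov single show "X \<in> P" by metis
    qed
    with nt show False by (simp add: trivial_partition_def)
  qed
  show "\<exists>x\<in>?V. \<exists>y\<in>?V. \<not> same_part P x y"
  proof (rule ccontr)
    assume n: "\<not> ?thesis"
    have full: "X = ?V" if X: "X \<in> P" for X
    proof
      show "?V \<subseteq> X"
      proof
        fix y assume y: "y \<in> ?V"
        obtain x where x: "x \<in> X" using sub[OF X] by blast
        then have "same_part P x y" using n y sub(1)[OF X] by blast
        then obtain Y where "Y \<in> P" "x \<in> Y" "y \<in> Y" by (auto simp: same_part_def)
        with x X P show "y \<in> X" unfolding is_partition_def by blast
      qed
    qed (use sub X in blast)
    have "P \<noteq> {}" using cov[OF zero_in_Vsp] by blast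
    with full have "P = {?V}" by blast
    with nt show False by (simp add: trivial_partition_def)
  qed
qed

lemma subgroup_TV_subspace:
  assumes "subgroup_TV n T"
  defines "U \<equiv> {v \<in> Vsp n. transl v \<in> T}"
  shows "subspace n U" "card U = card T"
proof -
  have T: "T \<subseteq> transl ` Vsp n" "id \<in> T" "\<And>s t. s \<in> T \<Longrightarrow> t \<in> T \<Longrightarrow> s \<circ> t \<in> T"
    using assms by (auto simp: subgroup_TV_def TV_def)
  have "transl zero = id" by (auto simp: transl_def)
  moreover have "transl u \<circ> transl v = transl (vadd u v)" for u v
    by (auto simp: transl_def vadd_ac fun_eq_iff)
  ultimately show "subspace n U" using T by (auto simp: subspace_def U_def) metis
  have "inj_on transl U"
  proof (rule inj_onI)
    fix u v assume "transl u = transl v"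
    then have "transl u zero = transl v zero" by simp
    then show "u = v" by (simp add: transl_def)
  qed
  moreover have "transl ` U = T" using T(1) by (auto simp: U_def)
  ultimately show "card U = card T" using card_image by metis
qed

lemma half_invariant_same_part:
  assumes n: "n > 0" and P: "is_partition (Vsp n) P" and F: "\<And>s. s \<in> Vsp n \<Longrightarrow> F s \<in> Vsp n"
    and U: "subspace n U" "2 ^ (n - 1) \<le> card U"
    and sub: "U \<subseteq> stab n (\<lambda>s t. same_part P (F s) (F t))"
  shows "half_invariant n (\<lambda>s t. same_part P (F s) (F t))"
  unfolding half_invariant_def
proof (intro conjI ballI impI)
  note E = same_part_equiv[OF P]
  show "same_part P (F s) (F s)" if "s \<in> Vsp n" for s using E(1)[OF F[OF that]] .
  show "same_part P (F t) (F s)" if "same_part P (F s) (F t)" for s t using E(2)[OF that] .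
  show "same_part P (F s) (F u)" if "same_part P (F s) (F t)" "same_part P (F t) (F u)" for s t u
    using E(3)[OF that] .
  fix u v assume "u \<in> Vsp n - stab n (\<lambda>s t. same_part P (F s) (F t))"
    "v \<in> Vsp n - stab n (\<lambda>s t. same_part P (F s) (F t))"
  with sub index2_iff[OF U(1) n] U(2)
  show "vadd u v \<in> stab n (\<lambda>s t. same_part P (F s) (F t))" by blast
qed

section \<open>Encryption functions as compositions of rounds\<close>

lemma enc_cong:
  "(\<And>h. h \<in> {1..r} \<Longrightarrow> ks h = ks' h) \<Longrightarrow> enc m b g lam ks r x = enc m b g lam ks' r x"
  by (induction r) auto

lemma enc_add:
  "enc m b g lam ks (r + d) x =
   enc m b (\<lambda>h. g (r + h)) (\<lambda>h. lam (r + h)) (\<lambda>h. ks (r + h)) d (enc m b g lam ks r x)"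
  by (induction d) auto

lemma bij_vadd: "v \<in> Vsp n \<Longrightarrow> bij_betw (\<lambda>x. vadd x v) (Vsp n) (Vsp n)"
  by (rule bij_betw_byWitness[where f' = "\<lambda>x. vadd x v"]) (auto simp: vadd.assoc)

lemma bij_enc:
  assumes "\<And>h j. h \<in> {1..r} \<Longrightarrow> j < b \<Longrightarrow> bij_betw (g h j) (Vsp m) (Vsp m)"
    and "\<And>h. h \<in> {1..r} \<Longrightarrow> lam h \<in> GLV (m * b)"
    and "\<And>h. h \<in> {1..r} \<Longrightarrow> ks h \<in> Vsp (m * b)"
  shows "bij_betw (enc m b g lam ks r) (Vsp (m * b)) (Vsp (m * b))"
  using assms
proof (induction r)
  case 0
  then show ?case by (simp add: bij_betw_def inj_on_def image_def)
next
  case (Suc r)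
  let ?V = "Vsp (m * b)"
  have "bij_betw (enc m b g lam ks r) ?V ?V" by (rule Suc.IH) (use Suc.prems in auto)
  moreover have "bij_betw (par m b (g (Suc r))) ?V ?V" by (rule bij_par) (use Suc.prems(1) in auto)
  moreover have "bij_betw (lam (Suc r)) ?V ?V" using GLV_D(1) Suc.prems(2) by auto
  moreover have "bij_betw (\<lambda>x. vadd x (ks (Suc r))) ?V ?V" using bij_vadd Suc.prems(3) by auto
  ultimately have "bij_betw ((\<lambda>x. vadd x (ks (Suc r))) \<circ> (lam (Suc r) \<circ>
      (par m b (g (Suc r)) \<circ> enc m b g lam ks r))) ?V ?V"
    by (intro bij_betw_trans)
  then show ?case by (simp add: o_def)
qed

text \<open>Isolates the three varying round keys; the other rounds use only \<open>kbar\<close>. As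
  \<open>enc\<close> counts rounds from one, the final rounds are renumbered by a shift of
  \<open>i + 1\<close>.\<close>

lemma enc_three:
  assumes i: "2 \<le> i" "i \<le> l - 1"
    and ks: "\<forall>h\<in>{1..l}. ks h =
      (if h = i - 1 then x else if h = i then y else if h = i + 1 then z else kbar h)"
  shows "enc m b g lam ks l v =
    enc m b (\<lambda>h. g (i + 1 + h)) (\<lambda>h. lam (i + 1 + h)) (\<lambda>h. kbar (i + 1 + h)) (l - (i + 1))
      (vadd (lam (i + 1) (par m b (g (i + 1))
        (vadd (lam i (par m b (g i)
          (vadd (lam (i - 1) (par m b (g (i - 1)) (enc m b g lam kbar (i - 2) v))) x))) y))) z)"
proof -
  obtain e where e: "i = Suc (Suc e)" using i(1) by (metis add_2_eq_Suc le_Suc_ex)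
  have l: "i + 1 + (l - (i + 1)) = l" using i by simp
  have "enc m b g lam ks e v = enc m b g lam kbar e v"
    by (rule enc_cong) (use ks i e in auto)
  then have mid: "enc m b g lam ks (i + 1) v =
      (vadd (lam (i + 1) (par m b (g (i + 1))
        (vadd (lam i (par m b (g i)
          (vadd (lam (i - 1) (par m b (g (i - 1)) (enc m b g lam kbar (i - 2) v))) x))) y))) z)"
    using ks i e by simp
  have "enc m b g lam ks l v = enc m b (\<lambda>h. g (i + 1 + h)) (\<lambda>h. lam (i + 1 + h))
      (\<lambda>h. ks (i + 1 + h)) (l - (i + 1)) (enc m b g lam ks (i + 1) v)"
    using enc_add[of m b g lam ks "i + 1" "l - (i + 1)" v] unfolding l .
  also have "\<dots> = enc m b (\<lambda>h. g (i + 1 + h)) (\<lambda>h. lam (i + 1 + h))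
      (\<lambda>h. kbar (i + 1 + h)) (l - (i + 1)) (enc m b g lam ks (i + 1) v)"
    by (rule enc_cong) (use ks i in auto)
  finally show ?thesis unfolding mid .
qed

section \<open>Primitivity of the generated group\<close>

lemma gen_group_comp: "h \<in> gen_group G \<Longrightarrow> g \<in> gen_group G \<Longrightarrow> h \<circ> g \<in> gen_group G"
  by (induction h rule: gen_group.induct) (auto simp: comp_assoc intro: gen_group.intros)

lemma gen_group_inverse:
  assumes bij: "\<And>s. s \<in> G \<Longrightarrow> bij s" and g: "g \<in> gen_group G"
  shows "\<exists>h\<in>gen_group G. h \<circ> g = id"
  using g
proof (induction rule: gen_group.induct)
  case gen_id
  show ?case by (rule bexI[OF comp_id gen_group.gen_id])
next
  case (gen_mult g s)
  then obtain h where h: "h \<in> gen_group G" "h \<circ> g = id" by blast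
  have "inv s \<circ> id \<in> gen_group G" using gen_group.gen_inv gen_group.gen_id gen_mult by blast
  then have "h \<circ> inv s \<in> gen_group G" using gen_group_comp[OF h(1)] by simp
  moreover have "(h \<circ> inv s) \<circ> (s \<circ> g) = id"
    using h(2) bij_is_inj[OF bij[OF gen_mult(2)]] by (simp add: fun_eq_iff)
  ultimately show ?case by blast
next
  case (gen_inv g s)
  then obtain h where h: "h \<in> gen_group G" "h \<circ> g = id" by blast
  have "s \<circ> id \<in> gen_group G" using gen_group.gen_mult gen_group.gen_id gen_inv by blast
  then have "h \<circ> s \<in> gen_group G" using gen_group_comp[OF h(1)] by simp
  moreover have "(h \<circ> s) \<circ> (inv s \<circ> g) = id"
    using h(2) bij_is_surj[OF bij[OF gen_inv(2)]] by (simp add: fun_eq_iff surj_f_inv_f)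
  ultimately show ?case by blast
qed

lemma gen_group_image:
  assumes bij: "\<And>s. s \<in> G \<Longrightarrow> bij s" "\<And>s. s \<in> G \<Longrightarrow> s ` S = S"
    and g: "g \<in> gen_group G" and x: "x \<in> S"
  shows "g x \<in> S"
  using g
proof (induction rule: gen_group.induct)
  case (gen_inv g s)
  then have "g x \<in> s ` S" using bij by simp
  then show ?case using bij_is_inj[OF bij(1)[OF gen_inv(2)]] by auto
qed (use x bij in auto)

definition orbit :: "(vec \<Rightarrow> vec) set \<Rightarrow> vec \<Rightarrow> vec set" where
  "orbit G x = {g x | g. g \<in> gen_group G}"

lemma orbitI: "g \<in> gen_group G \<Longrightarrow> g x \<in> orbit G x"
  by (auto simp: orbit_def)

lemma self_in_orbit: "x \<in> orbit G x"
  using orbitI[OF gen_group.gen_id, of x G] by simp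

lemma orbit_eq:
  assumes bij: "\<And>s. s \<in> G \<Longrightarrow> bij s" and y: "y \<in> orbit G x"
  shows "orbit G y = orbit G x"
proof -
  from y obtain g where g: "g \<in> gen_group G" "y = g x" by (auto simp: orbit_def)
  from gen_group_inverse[OF bij g(1)] obtain h where h: "h \<in> gen_group G" "h \<circ> g = id" by blast
  have x: "x = h y" using h(2) g(2) by (metis comp_apply id_apply)
  have "k y \<in> orbit G x" if "k \<in> gen_group G" for k
    using orbitI[OF gen_group_comp[OF that g(1)], of x] g(2) by simp
  moreover have "k x \<in> orbit G y" if "k \<in> gen_group G" for k
    using orbitI[OF gen_group_comp[OF that h(1)], of y] by (simp flip: x)
  ultimately show ?thesis by (auto simp: orbit_def)
qed

lemma orbit_partition:
  assumes bij: "\<And>s. s \<in> G \<Longrightarrow> bij s" "\<And>s. s \<in> G \<Longrightarrow> s ` S = S"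
  shows "is_partition S (orbit G ` S)"
    and "s \<in> G \<Longrightarrow> maps_partition s (orbit G ` S) (orbit G ` S)"
proof -
  have "orbit G x \<subseteq> S" if "x \<in> S" for x
    using gen_group_image[OF bij _ that] by (auto simp: orbit_def)
  moreover have "orbit G x = orbit G y" if "z \<in> orbit G x" "z \<in> orbit G y" for x y z
    using orbit_eq[OF bij(1) that(1)] orbit_eq[OF bij(1) that(2)] by simp
  ultimately show "is_partition S (orbit G ` S)"
    unfolding is_partition_def using self_in_orbit by blast
  assume s: "s \<in> G"
  have "s ` orbit G x = orbit G x" for x
  proof
    show "s ` orbit G x \<subseteq> orbit G x"
    proof clarify
      fix y assume "y \<in> orbit G x"
      then obtain g where g: "g \<in> gen_group G" "y = g x" by (auto simp: orbit_def)
      from gen_group.gen_mult[OF g(1) s] show "s y \<in> orbit G x" using orbitI[of "s \<circ> g" G x] g(2) by simp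
    qed
    show "orbit G x \<subseteq> s ` orbit G x"
    proof
      fix y assume "y \<in> orbit G x"
      then obtain g where g: "g \<in> gen_group G" "y = g x" by (auto simp: orbit_def)
      from gen_group.gen_inv[OF g(1) s] have "inv s y \<in> orbit G x" using orbitI[of "inv s \<circ> g" G x] g(2) by simp
      moreover have "y = s (inv s y)" using surj_f_inv_f[OF bij_is_surj[OF bij(1)[OF s]]] by metis
      ultimately show "y \<in> s ` orbit G x" by blast
    qed
  qed
  then show "maps_partition s (orbit G ` S) (orbit G ` S)"
    by (simp add: maps_partition_def image_image)
qed

text \<open>Bijectivity on the whole type is what makes \<open>inv\<close> in
  \<open>gen_group\<close> a genuine inverse.\<close>

lemma bij_ext_on:
  assumes f: "bij_betw f S S"
  shows "bij (ext_on S f)" "ext_on S f ` S = S"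
proof -
  have "bij_betw (ext_on S f) S S"
    using f by (rule bij_betw_cong[THEN iffD2, rotated]) (simp add: ext_on_def)
  moreover have "bij_betw (ext_on S f) (- S) (- S)"
    by (rule bij_betw_cong[THEN iffD2, rotated, of id]) (auto simp: ext_on_def)
  ultimately have "bij_betw (ext_on S f) (S \<union> - S) (S \<union> - S)" by (rule bij_betw_combine) simp
  then show "bij (ext_on S f)" by simp
  show "ext_on S f ` S = S" using f by (simp add: ext_on_def bij_betw_def)
qed

lemma maps_partition_ext_on:
  assumes "is_partition S P"
  shows "maps_partition (ext_on S f) P Q \<longleftrightarrow> maps_partition f P Q"
proof -
  have "(\<lambda>A. ext_on S f ` A) ` P = (\<lambda>A. f ` A) ` P"
  proof (rule image_cong[OF refl])
    fix A assume "A \<in> P"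
    then have "A \<subseteq> S" using assms by (simp add: is_partition_def)
    then show "ext_on S f ` A = f ` A" by (intro image_cong) (auto simp: ext_on_def)
  qed
  then show ?thesis by (simp add: maps_partition_def)
qed

text \<open>The orbits form an invariant partition, hence a trivial one. The moved point
  \<open>x0\<close> rules out singletons, so there is only one orbit.\<close>

lemma primitive_if_no_partition:
  assumes np: "\<And>P. is_partition S P \<Longrightarrow> \<forall>k\<in>K. maps_partition (e k) P P \<Longrightarrow> trivial_partition S P"
    and bij: "\<And>k. k \<in> K \<Longrightarrow> bij_betw (e k) S S"
    and moves: "k \<in> K" "x0 \<in> S" "e k x0 \<noteq> x0"
  shows "primitive_on S (gen_group ((\<lambda>k. ext_on S (e k)) ` K))"
proof -
  define G where "G = (\<lambda>k. ext_on S (e k)) ` K"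
  have G: "bij s" "s ` S = S" if "s \<in> G" for s
    using that bij_ext_on[OF bij] by (auto simp: G_def)
  note op = orbit_partition[of G S, OF G]
  have "\<forall>k\<in>K. maps_partition (e k) (orbit G ` S) (orbit G ` S)"
    using op(2) maps_partition_ext_on[OF op(1)] unfolding G_def by blast
  from np[OF op(1) this] have triv: "trivial_partition S (orbit G ` S)" .
  have eq: "orbit G ` S = {S}"
  proof (rule ccontr)
    assume "orbit G ` S \<noteq> {S}"
    with triv have "orbit G ` S = (\<lambda>x. {x}) ` S" by (auto simp: trivial_partition_def)
    then have "orbit G x0 \<in> (\<lambda>x. {x}) ` S" using moves(2) by blast
    then have "orbit G x0 = {x0}" using self_in_orbit[of x0 G] by auto
    moreover have "ext_on S (e k) \<circ> id \<in> gen_group G"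
      by (intro gen_group.intros) (use moves(1) G_def in blast)
    then have "ext_on S (e k) x0 \<in> orbit G x0" using orbitI[of "ext_on S (e k) \<circ> id" G x0] by simp
    ultimately show False using moves by (simp add: ext_on_def)
  qed
  have "\<exists>g\<in>gen_group G. g x = y" if "x \<in> S" "y \<in> S" for x y
  proof -
    have "orbit G x = S" using eq that(1) by blast
    with that(2) show ?thesis unfolding orbit_def by blast
  qed
  moreover have "trivial_partition S P"
    if P: "is_partition S P" and inv: "\<forall>g\<in>gen_group G. maps_partition g P P" for P
  proof (rule np[OF P], rule ballI)
    fix k assume "k \<in> K"
    then have "ext_on S (e k) \<circ> id \<in> gen_group G"
      by (intro gen_group.intros) (use G_def in blast)
    with inv show "maps_partition (e k) P P" by (auto simp: maps_partition_ext_on[OF P])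
  qed
  ultimately show ?thesis unfolding primitive_on_def G_def by blast
qed

section \<open>The main theorem\<close>

theorem theorem3p21:
  fixes m b l i :: nat
    and K :: "'k set"
    and \<Phi> :: "'k \<Rightarrow> nat \<Rightarrow> vec"
    and g :: "nat \<Rightarrow> nat \<Rightarrow> vec \<Rightarrow> vec"
    and lam :: "nat \<Rightarrow> vec \<Rightarrow> vec"
    and T1 T2 T3 :: "(vec \<Rightarrow> vec) set"
  assumes mb: "m > 1" "b > 1"
    and sbox_perm: "\<And>h j. h \<in> {1..l} \<Longrightarrow> j < b \<Longrightarrow> bij_betw (g h j) (Vsp m) (Vsp m)"
    and sbox_zero: "\<And>h j. h \<in> {1..l} \<Longrightarrow> j < b \<Longrightarrow> g h j zero = zero"
    and lam_GL: "\<And>h. h \<in> {1..l} \<Longrightarrow> lam h \<in> GLV (m*b)"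
    and Phi_V: "\<And>k h. k \<in> K \<Longrightarrow> h \<in> {1..l} \<Longrightarrow> \<Phi> k h \<in> Vsp (m*b)"
    and i_range: "2 \<le> i" "i \<le> l - 1"
    and T_sub: "subgroup_TV (m*b) T1" "subgroup_TV (m*b) T2" "subgroup_TV (m*b) T3"
    and T_ord: "card T1 \<ge> 2 ^ (m*b - 1)" "card T2 \<ge> 2 ^ (m*b - 1)" "card T3 \<ge> 2 ^ (m*b - 1)"
    and almost_indep: "\<exists>kbar. (\<forall>h. kbar h \<in> Vsp (m*b)) \<and>
        (\<forall>x\<in>{v \<in> Vsp (m*b). transl v \<in> T1}. \<forall>y\<in>{v \<in> Vsp (m*b). transl v \<in> T2}.
         \<forall>z\<in>{v \<in> Vsp (m*b). transl v \<in> T3}.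
           \<exists>k\<in>K. \<forall>h\<in>{1..l}. \<Phi> k h =
              (if h = i - 1 then x else if h = i then y else if h = i + 1 then z else kbar h))"
    and sboxes: "(\<exists>r. r < m - 1 \<and> (\<forall>h\<in>{i, i+1}. \<forall>j<b.
                      diff_uniform m (g h j) (2 ^ r) \<and> strongly_anti_invariant m (g h j) r))
              \<or> (\<forall>h\<in>{i, i+1}. \<forall>j<b. diff_uniform m (g h j) 4 \<and> nhat m (g h j) = 0)"
    and lam_proper: "strongly_proper m b (lam i)"
    and J_disj: "Jset m b {v \<in> Vsp (m*b). lam i v \<in> {u \<in> Vsp (m*b). transl u \<in> T2}}
                 \<inter> Jset m b {v \<in> Vsp (m*b). transl v \<in> T1} = {}"
  shows "\<not> (\<exists>A B. is_partition (Vsp (m*b)) A \<and> \<not> trivial_partition (Vsp (m*b)) A \<and>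
                 is_partition (Vsp (m*b)) B \<and> \<not> trivial_partition (Vsp (m*b)) B \<and>
                 (\<forall>k\<in>K. maps_partition (enc m b g lam (\<Phi> k) l) A B))
         \<and> primitive_on (Vsp (m*b))
             (gen_group ((\<lambda>k. ext_on (Vsp (m*b)) (enc m b g lam (\<Phi> k) l)) ` K))"
proof -
  define n where "n = m * b"
  define V where "V = Vsp n"
  define U1 U2 U3 where "U1 = {v \<in> V. transl v \<in> T1}" and "U2 = {v \<in> V. transl v \<in> T2}"
    and "U3 = {v \<in> V. transl v \<in> T3}"
  define E where "E k = enc m b g lam (\<Phi> k) l" for k
  have n1: "n > 1"
  proof -
    have "1 * 1 < m * b" by (rule mult_strict_mono) (use mb in auto)
    then show ?thesis by (simp add: n_def)
  qed
  have U: "subspace n U1" "2 ^ (n - 1) \<le> card U1" "subspace n U2" "2 ^ (n - 1) \<le> card U2"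
    "subspace n U3" "2 ^ (n - 1) \<le> card U3"
    using subgroup_TV_subspace[OF T_sub(1)] subgroup_TV_subspace[OF T_sub(2)]
      subgroup_TV_subspace[OF T_sub(3)] T_ord
    by (simp_all add: U1_def U2_def U3_def V_def n_def)
  note zU = U(1,3,5)[THEN subspaceD(2)]
  have UV: "U1 \<subseteq> V" "U2 \<subseteq> V" "U3 \<subseteq> V" by (auto simp: U1_def U2_def U3_def)
  obtain kbar where kbar: "\<And>h. kbar h \<in> V"
    and ind: "\<And>x y z. x \<in> U1 \<Longrightarrow> y \<in> U2 \<Longrightarrow> z \<in> U3 \<Longrightarrow> \<exists>k\<in>K. \<forall>h\<in>{1..l}. \<Phi> k h =
              (if h = i - 1 then x else if h = i then y else if h = i + 1 then z else kbar h)"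
    using almost_indep unfolding U1_def U2_def U3_def V_def n_def by blast
  have il: "i - 1 \<in> {1..l}" "i \<in> {1..l}" "i + 1 \<in> {1..l}" using i_range by auto
  \<comment> \<open>Encryption factors as \<open>pre\<close>, add \<open>x\<close>,
    \<open>L\<close>, add \<open>y\<close>, \<open>L'\<close>, add \<open>z\<close>,
    \<open>suf\<close>, with four bijections that do not depend on the free keys.\<close>
  define pre where "pre v = lam (i - 1) (par m b (g (i - 1)) (enc m b g lam kbar (i - 2) v))" for v
  define L where "L v = lam i (par m b (g i) v)" for v
  define L' where "L' v = lam (i + 1) (par m b (g (i + 1)) v)" for v
  define suf where "suf = enc m b (\<lambda>h. g (i + 1 + h)) (\<lambda>h. lam (i + 1 + h))
    (\<lambda>h. kbar (i + 1 + h)) (l - (i + 1))"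
  have round_bij: "bij_betw (\<lambda>v. lam h (par m b (g h) v)) V V" if "h \<in> {1..l}" for h
    using bij_betw_trans[OF bij_par GLV_D(1)[OF lam_GL[OF that]], of "g h"] sbox_perm[OF that]
    by (simp add: o_def V_def n_def)
  have L: "bij_betw L V V" "bij_betw L' V V"
    using round_bij[OF il(2)] round_bij[OF il(3)] by (simp_all add: L_def[abs_def] L'_def[abs_def])
  have suf: "bij_betw suf V V"
    unfolding suf_def V_def n_def
    by (rule bij_enc) (use sbox_perm lam_GL kbar i_range in \<open>auto simp: V_def n_def\<close>)
  have pre: "bij_betw pre V V"
  proof -
    have "bij_betw (enc m b g lam kbar (i - 2)) V V"
      unfolding V_def n_def
      by (rule bij_enc) (use sbox_perm lam_GL kbar i_range in \<open>auto simp: V_def n_def\<close>)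
    from bij_betw_trans[OF this round_bij[OF il(1)]] show ?thesis by (simp add: pre_def[abs_def] o_def)
  qed
  have E_bij: "bij_betw (E k) V V" if "k \<in> K" for k
    unfolding E_def V_def n_def by (rule bij_enc) (use sbox_perm lam_GL Phi_V that in auto)
  have E_eq: "\<exists>k\<in>K. \<forall>v. E k v = suf (vadd (L' (vadd (L (vadd (pre v) x)) y)) z)"
    if xyz: "x \<in> U1" "y \<in> U2" "z \<in> U3" for x y z
  proof -
    from ind[OF xyz] obtain k where k: "k \<in> K" and eq: "\<forall>h\<in>{1..l}. \<Phi> k h =
              (if h = i - 1 then x else if h = i then y else if h = i + 1 then z else kbar h)" by blast
    have "E k v = suf (vadd (L' (vadd (L (vadd (pre v) x)) y)) z)" for v
      unfolding E_def suf_def L_def L'_def pre_def by (rule enc_three[OF i_range eq])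
    with k show ?thesis by blast
  qed
  have no_partition: False
    if A: "is_partition V A" "\<not> trivial_partition V A" and B: "is_partition V B"
      and AB: "\<forall>k\<in>K. maps_partition (E k) A B" for A B
  proof -
    \<comment> \<open>The partition \<open>B\<close> is pulled back to the points right after the
      three key additions, with the later free keys set to zero.\<close>
    define R1 where "R1 s t = same_part B (suf (L' (L s)) ) (suf (L' (L t)))" for s t
    define R2 where "R2 s t = same_part B (suf (L' s)) (suf (L' t))" for s t
    define R3 where "R3 s t = same_part B (suf s) (suf t)" for s t
    note LV = L[THEN bij_betw_apply]
    have key: "same_part A v w \<longleftrightarrow> same_part B (suf (vadd (L' (vadd (L (vadd (pre v) x)) y)) z))
        (suf (vadd (L' (vadd (L (vadd (pre w) x)) y)) z))"
      if vw: "v \<in> V" "w \<in> V" and xyz: "x \<in> U1" "y \<in> U2" "z \<in> U3" for v w x y z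
    proof -
      from E_eq[OF xyz] obtain k where k: "k \<in> K"
        and e: "\<And>v. E k v = suf (vadd (L' (vadd (L (vadd (pre v) x)) y)) z)" by blast
      from same_part_map[OF A(1) E_bij[OF k] _ vw] AB k show ?thesis by (simp add: e)
    qed
    note key0 = key[OF _ _ zU, simplified]
    have pre_ex: "\<exists>v\<in>V. s = pre v" if "s \<in> V" for s
      using pre that by (auto simp: bij_betw_def)
    have L_ex: "\<exists>v\<in>V. s = L (pre v)" if "s \<in> V" for s
    proof -
      have "s \<in> L ` V" using L(1) that by (simp add: bij_betw_def)
      then show ?thesis using pre_ex by blast
    qed
    have L'_ex: "\<exists>v\<in>V. s = L' (L (pre v))" if "s \<in> V" for s
    proof -
      have "s \<in> L' ` V" using L(2) that by (simp add: bij_betw_def)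
      then show ?thesis using L_ex by blast
    qed
    \<comment> \<open>The keys \<open>u\<close> and \<open>zero\<close> at this addition, with zero
      at the other two, both compare \<open>B\<close> with the same \<open>same_part A\<close>.
      Surjectivity of \<open>pre\<close> reaches every pair of points.\<close>
    have inv1: "R1 (vadd s u) (vadd t u)" if a: "u \<in> U1" "s \<in> V" "t \<in> V" "R1 s t" for u s t
    proof -
      obtain v w where "v \<in> V" "w \<in> V" "s = pre v" "t = pre w" using pre_ex[OF a(2)] pre_ex[OF a(3)] by blast
      then show ?thesis using key[OF _ _ a(1) zU(2,3)] key0 a(4) by (simp add: R1_def)
    qed
    have inv2: "R2 (vadd s u) (vadd t u)" if a: "u \<in> U2" "s \<in> V" "t \<in> V" "R2 s t" for u s t
    proof -
      obtain v w where "v \<in> V" "w \<in> V" "s = L (pre v)" "t = L (pre w)" 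
        using L_ex[OF a(2)] L_ex[OF a(3)] by blast
      then show ?thesis using key[OF _ _ zU(1) a(1) zU(3)] key0 a(4) by (simp add: R2_def)
    qed
    have inv3: "R3 (vadd s u) (vadd t u)" if a: "u \<in> U3" "s \<in> V" "t \<in> V" "R3 s t" for u s t
    proof -
      obtain v w where "v \<in> V" "w \<in> V" "s = L' (L (pre v))" "t = L' (L (pre w))"
        using L'_ex[OF a(2)] L'_ex[OF a(3)] by blast
      then show ?thesis using key[OF _ _ zU(1,2) a(1)] key0 a(4) by (simp add: R3_def)
    qed
    have st: "U1 \<subseteq> stab n R1" "U2 \<subseteq> stab n R2" "U3 \<subseteq> stab n R3"
      using inv1 inv2 inv3 UV unfolding stab_def V_def by blast+
    have n0: "n > 0" using n1 by simp
    note sufV = bij_betw_apply[OF suf]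
    note hi = half_invariant_same_part[OF n0 B[unfolded V_def]]
    have hi1: "half_invariant n R1"
      unfolding R1_def[abs_def] by (rule hi[OF _ U(1,2)])
        (use st(1) sufV LV in \<open>auto simp: R1_def[abs_def] V_def\<close>)
    have hi2: "half_invariant n R2"
      unfolding R2_def[abs_def] by (rule hi[OF _ U(3,4)])
        (use st(2) sufV LV in \<open>auto simp: R2_def[abs_def] V_def\<close>)
    have hi3: "half_invariant n R3"
      unfolding R3_def[abs_def] by (rule hi[OF _ U(5,6)])
        (use st(3) sufV LV in \<open>auto simp: R3_def[abs_def] V_def\<close>)
    have nt: "nontriv n R1"
    proof (rule nontriv_map[OF pre[unfolded V_def], of "same_part A"])
      show "nontriv n (same_part A)" using nontriv_same_part A by (simp add: V_def)
    qed (simp add: key0 R1_def V_def)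
    have sb: "(\<forall>j<b. anti_inv_sbox m (g h j)) \<or> (\<forall>j<b. spanning_sbox m (g h j))" if "h \<in> {i, i + 1}" for h
      using sboxes that anti_inv_sboxI spanning_sboxI by metis
    show False
    proof (rule two_round_contradiction[where ?R1.0 = R1 and ?R2.0 = R2 and ?R3.0 = R3 and f = "g i"
          and f' = "g (i + 1)" and l = "lam i" and l' = "lam (i + 1)" and m = m and b = b])
      fix j assume j: "j < b"
      let ?W = "{v \<in> Vsp (m*b). lam i v \<in> {u \<in> Vsp (m*b). transl u \<in> T2}}"
      \<comment> \<open>A block outside the \<open>Jset\<close> of a subspace is contained in that
        subspace.\<close>
      have "j \<notin> Jset m b ?W \<or> j \<notin> Jset m b U1" using J_disj by (auto simp: U1_def V_def n_def)
      then have "blk m b j \<subseteq> ?W \<or> blk m b j \<subseteq> U1" using j unfolding Jset_def by blast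
      then show "blk m b j \<subseteq> stab (m * b) R1 \<or> blk m b j \<subseteq> {v \<in> Vsp (m * b). lam i v \<in> stab (m * b) R2}"
        using st unfolding n_def U2_def V_def by blast
    qed (use mb sbox_perm sbox_zero il sb lam_proper lam_GL hi1 hi2 hi3 nt
        in \<open>auto simp: R1_def R2_def R3_def L_def L'_def n_def\<close>)
  qed
  \<comment> \<open>Transitivity needs an encryption function that moves a point. If none did,
    changing the third key would leave the image of \<open>zero\<close> unchanged, against the
    injectivity of \<open>suf\<close>.\<close>
  have "\<exists>k\<in>K. \<exists>v\<in>V. E k v \<noteq> v"
  proof (rule ccontr)
    assume "\<not> ?thesis"
    then have fix_all: "E k v = v" if "k \<in> K" "v \<in> V" for k v using that by blast
    \<comment> \<open>The order bound exceeds one because \<open>n > 1\<close>, so a nonzero third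
      key exists.\<close>
    have "U3 \<noteq> {zero}"
    proof
      assume "U3 = {zero}"
      with U(6) have "(2::nat) ^ (n - 1) \<le> 1" by simp
      with one_less_power[of "2::nat" "n - 1"] n1 show False by simp
    qed
    with zU(3) obtain z where z: "z \<in> U3" "z \<noteq> zero" by blast
    let ?c = "L' (L (pre zero))"
    have c: "?c \<in> V" using pre L bij_betw_apply[of _ V V] by (auto simp: V_def)
    have suf_zero: "suf (vadd ?c z) = zero" if "z \<in> U3" for z
    proof -
      from E_eq[OF zU(1,2) that] obtain k where "k \<in> K" "E k zero = suf (vadd ?c z)" by auto
      with fix_all[of k zero] show ?thesis by (simp add: V_def)
    qed
    have "suf (vadd ?c z) = suf ?c" using suf_zero[OF z(1)] suf_zero[OF zU(3)] by simp
    moreover have "vadd ?c z \<in> V" using c z UV by (auto simp: V_def subset_eq)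
    ultimately have "vadd ?c z = ?c"
      using inj_onD[OF bij_betw_imp_inj_on[OF suf]] c by blast
    with z show False by simp
  qed
  then obtain k v where kv: "k \<in> K" "v \<in> V" "E k v \<noteq> v" by blast
  have "primitive_on V (gen_group ((\<lambda>k. ext_on V (E k)) ` K))"
    by (rule primitive_if_no_partition[where k = k and ?x0.0 = v])
      (use no_partition E_bij kv in blast)+
  with no_partition show ?thesis unfolding E_def V_def n_def by blast
qed

end
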